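(* Let $A$ be a finite set of $n:=|A|\ge 3$ integers with $\min(A)=0$ and $\gcd(A)=1$, and let $l:=\max(A)$. Let $\mathcal{E}$ be the exceptional set of $A$ and $\mathcal{E}'$ the exceptional set of $l-A=\{l-a\colon a\in A\}$. Put $M:=l-n+2$. Then for every integer $m\ge M$, $$ mA=[0,ml]\setminus\big(\mathcal{E}\cup(ml-\mathcal{E}')\big). $$ Moreover, for every integer $m\ge M$ the interval $[\max(\mathcal{E})+1,\ \min(ml-\mathcal{E}')-1]$ is nonempty and contained in $mA$; indeed, writing $l-1=k(n-2)+r$ with integers $k\ge 1$ and $r\in[0,n-3]$, we have $$ \min(ml-\mathcal{E}')-\max(\mathcal{E})\ \ge\ (m-M+1)l+\Delta, $$ where $$ \Delta=l(k-1)(n-3)+rk(n-3)+r^2+k+1\ \ge 2. $$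
   Context: For a finite set $A$ of integers and a positive integer $m$, $mA:=\{a_1+\dots+a_m\colon a_1,\dots,a_m\in A\}$ is the $m$-fold sumset (summands not necessarily distinct). For integers $x\le y$, $[x,y]$ denotes the set of integers $z$ with $x\le z\le y$. For a set $B$ of integers and an integer $c$, $c-B:=\{c-b\colon b\in B\}$. The exceptional set $\mathcal{E}(B)$ of a finite set $B$ of nonnegative integers with $\min(B)=0$ and $\gcd(B)=1$ is the set of all positive integers that cannot be written as a nonnegative integer linear combination of elements of $B$ (the complement in the positive integers of the additive semigroup generated by $B$); it is finite. Convention: if $\mathcal{E}=\emptyset$ then $\max(\mathcal{E})=-1$, and similarly $\max(\mathcal{E}')=-1$ if $\mathcal{E}'=\emptyset$, so that $\min(ml-\mathcal{E}')=ml-\max(\mathcal{E}')$ in all cases. *)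

theory Defs
  imports Main
begin

definition mfold_sumset :: "nat \<Rightarrow> int set \<Rightarrow> int set" where
  "mfold_sumset m A = {\<Sum>i<m. a i | a. \<forall>i<m. a i \<in> A}"

definition reflect :: "int \<Rightarrow> int set \<Rightarrow> int set" where
  "reflect c B = (\<lambda>b. c - b) ` B"

definition exceptional_set :: "int set \<Rightarrow> int set" where
  "exceptional_set B =
     {x. x > 0 \<and> \<not> (\<exists>c :: int \<Rightarrow> nat. x = (\<Sum>b\<in>B. int (c b) * b))}"

text \<open>The maximum of an empty exceptional set is \<open>-1\<close> by convention; accordingly the
  minimum of the reflection of an empty exceptional set about \<open>c\<close> is \<open>c + 1\<close>.\<close>

definition exc_max :: "int set \<Rightarrow> int" where
  "exc_max E = (if E = {} then - 1 else Max E)"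

definition reflect_min :: "int \<Rightarrow> int set \<Rightarrow> int" where
  "reflect_min c E = (if E = {} then c + 1 else Min (reflect c E))"

lemma reflect_min_eq:
  assumes "finite E"
  shows "reflect_min c E = c - exc_max E"
proof (cases "E = {}")
  case False
  have "Min ((\<lambda>b. c - b) ` E) = c - Max E"
    using assms False by (intro Min_eqI) (auto intro: imageI Max_in)
  with False show ?thesis
    by (simp add: reflect_min_def exc_max_def reflect_def)
qed (simp add: reflect_min_def exc_max_def)

end

theory Submission
  imports Defs "HOL-Library.Set_Algebras" "HOL-Library.Multiset"
begin

text \<open>
  Saturation: if \<open>mA\<close> misses an admissible \<open>x\<close>, one may move \<open>x\<close> and increase \<open>m\<close> so that \<open>x\<close> has
  representations by \<open>m + 1\<close> elements of \<open>A\<close>, and \<open>ml - x\<close> by \<open>m + 1\<close> elements of \<open>l - A\<close>. Take both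
  with as many summands \<open>l\<close> as possible and order the remaining summands decreasingly. Their partial
  sums of length at least two are distinct modulo \<open>l\<close> and avoid \<open>A\<close> modulo \<open>l\<close>, so if \<open>m\<close> is at least
  \<open>l - n + 2\<close>, many partial sums of the first sequence agree modulo \<open>l\<close> with a negated partial sum
  of the second. Exchanging two such initial segments shortens one of the representations, unless
  the segments are very short; so there are too few coincidences.

  Gap: Lev's inequality \<open>|hA| \<ge> |(h-1)A| + min(l, h(n-2)+1)\<close>, summed over \<open>h\<close> and compared with the
  structure of \<open>mA\<close> for large \<open>m\<close>, bounds \<open>|E| + |E'|\<close>. Since \<open>x\<close> or \<open>max E - x\<close> is exceptional for
  \<open>0 \<le> x \<le> max E\<close>, we have \<open>max E \<le> 2|E| - 1\<close>, and likewise for \<open>E'\<close>.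
\<close>

section \<open>Sumsets and the semigroup\<close>

lemma mfold_sumset_iff_list:
  "x \<in> mfold_sumset m A \<longleftrightarrow> (\<exists>xs. set xs \<subseteq> A \<and> length xs = m \<and> sum_list xs = x)"
proof
  assume "x \<in> mfold_sumset m A"
  then obtain a where a: "\<forall>i<m. a i \<in> A" "x = (\<Sum>i<m. a i)"
    by (auto simp: mfold_sumset_def)
  have "sum_list (map a [0..<m]) = x"
    using a(2) by (simp add: interv_sum_list_conv_sum_set_nat atLeast0LessThan)
  then show "\<exists>xs. set xs \<subseteq> A \<and> length xs = m \<and> sum_list xs = x"
    using a(1) by (intro exI[of _ "map a [0..<m]"]) auto
next
  assume "\<exists>xs. set xs \<subseteq> A \<and> length xs = m \<and> sum_list xs = x"
  then obtain xs where xs: "set xs \<subseteq> A" "length xs = m" "sum_list xs = x"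
    by blast
  then have "x = (\<Sum>i<m. xs ! i)" "\<forall>i<m. xs ! i \<in> A"
    by (auto simp: sum_list_sum_nth atLeast0LessThan)
  then show "x \<in> mfold_sumset m A"
    by (auto simp: mfold_sumset_def)
qed

lemma mfold_sumsetI:
  "set xs \<subseteq> A \<Longrightarrow> length xs = m \<Longrightarrow> sum_list xs = x \<Longrightarrow> x \<in> mfold_sumset m A"
  by (auto simp: mfold_sumset_iff_list)

lemma mfold_sumset_0 [simp]: "mfold_sumset 0 A = {0}"
  by (auto simp: mfold_sumset_iff_list)

lemma mfold_sumset_add:
  "mfold_sumset (m + k) A = mfold_sumset m A + mfold_sumset k A"
proof (intro set_eqI iffI)
  fix x assume "x \<in> mfold_sumset (m + k) A"
  then obtain xs where xs: "set xs \<subseteq> A" "length xs = m + k" "sum_list xs = x"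
    by (auto simp: mfold_sumset_iff_list)
  have "x = sum_list (take m xs) + sum_list (drop m xs)"
    using xs(3) by (metis append_take_drop_id sum_list_append)
  moreover have "sum_list (take m xs) \<in> mfold_sumset m A"
    using xs by (intro mfold_sumsetI[of "take m xs"]) (auto dest: in_set_takeD)
  moreover have "sum_list (drop m xs) \<in> mfold_sumset k A"
    using xs by (intro mfold_sumsetI[of "drop m xs"]) (auto dest: in_set_dropD)
  ultimately show "x \<in> mfold_sumset m A + mfold_sumset k A"
    by (auto intro: set_plus_intro)
next
  fix x assume "x \<in> mfold_sumset m A + mfold_sumset k A"
  then obtain xs ys where "set xs \<subseteq> A" "length xs = m" "set ys \<subseteq> A" "length ys = k"
    "x = sum_list xs + sum_list ys"
    by (auto simp: mfold_sumset_iff_list elim!: set_plus_elim)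
  then show "x \<in> mfold_sumset (m + k) A"
    by (intro mfold_sumsetI[of "xs @ ys"]) auto
qed

lemma mfold_sumset_1 [simp]: "mfold_sumset (Suc 0) A = A"
  by (force simp: mfold_sumset_iff_list length_Suc_conv)

lemma mfold_sumset_Suc: "mfold_sumset (Suc m) A = mfold_sumset m A + A"
  using mfold_sumset_add[of m 1 A] by simp

lemma mfold_sumset_mono:
  assumes "0 \<in> A" "m \<le> k"
  shows "mfold_sumset m A \<subseteq> mfold_sumset k A"
proof
  fix x assume "x \<in> mfold_sumset m A"
  then obtain xs where "set xs \<subseteq> A" "length xs = m" "sum_list xs = x"
    by (auto simp: mfold_sumset_iff_list)
  then show "x \<in> mfold_sumset k A"
    using assms by (intro mfold_sumsetI[of "xs @ replicate (k - m) 0"]) (auto simp: sum_list_replicate)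
qed

lemma mfold_sumset_bounds:
  assumes "A \<subseteq> {0..l}"
  shows "mfold_sumset m A \<subseteq> {0..int m * l}"
proof (induction m)
  case (Suc m)
  show ?case
  proof
    fix x assume "x \<in> mfold_sumset (Suc m) A"
    then obtain y a where "y \<in> mfold_sumset m A" "a \<in> A" "x = y + a"
      by (auto simp: mfold_sumset_Suc elim!: set_plus_elim)
    then have "0 \<le> y" "y \<le> int m * l" "0 \<le> a" "a \<le> l" "x = y + a"
      using Suc assms by auto
    then show "x \<in> {0..int (Suc m) * l}"
      by (simp add: algebra_simps)
  qed
qed simp

lemma finite_mfold_sumset: "finite A \<Longrightarrow> finite (mfold_sumset m A)"
  by (induction m) (auto simp: mfold_sumset_Suc finite_set_plus)

lemma sum_list_map_reflect:
  "sum_list (map (\<lambda>b. l - b) xs) = int (length xs) * l - sum_list xs"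
  by (induction xs) (auto simp: algebra_simps)

lemma reflect_reflect [simp]: "reflect l (reflect l A) = A"
  by (force simp: reflect_def image_image)

lemma mem_reflect_iff: "x \<in> reflect l A \<longleftrightarrow> l - x \<in> A"
  by (force simp: reflect_def)

text \<open>Every summand \<open>b\<close> is replaced by \<open>l - b\<close>. As reflection is an
  involution, this one direction yields the equivalence.\<close>

lemma mfold_sumset_reflectD:
  assumes "x \<in> mfold_sumset m (reflect l A)"
  shows "int m * l - x \<in> mfold_sumset m A"
proof -
  from assms obtain xs where "set xs \<subseteq> reflect l A" "length xs = m" "sum_list xs = x"
    by (auto simp: mfold_sumset_iff_list)
  then show ?thesis
    by (intro mfold_sumsetI[of "map (\<lambda>b. l - b) xs"])
      (auto simp: sum_list_map_reflect mem_reflect_iff)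
qed

lemma mfold_sumset_reflect:
  "x \<in> mfold_sumset m (reflect l A) \<longleftrightarrow> int m * l - x \<in> mfold_sumset m A"
  using mfold_sumset_reflectD[of x m l A] mfold_sumset_reflectD[of "int m * l - x" m l "reflect l A"]
  by auto

text \<open>Coefficients are multiplicities in a list of summands; from here on exceptional sets are
  handled through sumsets alone.\<close>

lemma combination_iff_mfold_sumset:
  assumes "finite A"
  shows "(\<exists>c :: int \<Rightarrow> nat. x = (\<Sum>b\<in>A. int (c b) * b)) \<longleftrightarrow> (\<exists>w. x \<in> mfold_sumset w A)"
proof
  assume "\<exists>c :: int \<Rightarrow> nat. x = (\<Sum>b\<in>A. int (c b) * b)"
  then obtain c :: "int \<Rightarrow> nat" where c: "x = (\<Sum>b\<in>A. int (c b) * b)"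
    by blast
  have "\<exists>xs. set xs \<subseteq> A \<and> sum_list xs = (\<Sum>b\<in>B. int (c b) * b)" if "B \<subseteq> A" for B
    using finite_subset[OF that assms] that
  proof (induction B rule: finite_induct)
    case (insert b B)
    then obtain xs where "set xs \<subseteq> A" "sum_list xs = (\<Sum>b\<in>B. int (c b) * b)"
      by auto
    then show ?case
      using insert by (intro exI[of _ "replicate (c b) b @ xs"]) (auto simp: sum_list_replicate)
  qed (auto intro: exI[of _ "[]"])
  then show "\<exists>w. x \<in> mfold_sumset w A"
    using c by (auto simp: mfold_sumset_iff_list)
next
  assume "\<exists>w. x \<in> mfold_sumset w A"
  then obtain xs where xs: "set xs \<subseteq> A" "sum_list xs = x"
    by (auto simp: mfold_sumset_iff_list)
  have "x = (\<Sum>b\<in>A. int (count_list xs b) * b)"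
    unfolding xs(2)[symmetric] using xs(1)
  proof (induction xs)
    case (Cons a xs)
    have "(\<Sum>b\<in>A. int (count_list (a # xs) b) * b)
        = (\<Sum>b\<in>A. int (count_list xs b) * b + (if b = a then a else 0))"
      by (intro sum.cong) (auto simp: algebra_simps)
    also have "\<dots> = (\<Sum>b\<in>A. int (count_list xs b) * b) + a"
      using Cons.prems assms by (simp add: sum.distrib)
    finally show ?case
      using Cons by simp
  qed simp
  then show "\<exists>c :: int \<Rightarrow> nat. x = (\<Sum>b\<in>A. int (c b) * b)"
    by blast
qed

lemma mem_exceptional_set_iff:
  "finite A \<Longrightarrow> x \<in> exceptional_set A \<longleftrightarrow> x > 0 \<and> (\<forall>w. x \<notin> mfold_sumset w A)"
  by (auto simp: exceptional_set_def combination_iff_mfold_sumset)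

section \<open>Saturation of the multiple sumsets\<close>

text \<open>A list of at most \<open>m\<close> summands could be padded with zeros to length
  \<open>m\<close>. Every exchange argument below ends in a contradiction or a bound through this
  fact.\<close>

lemma no_short_representation:
  assumes "0 \<in> A" "x \<notin> mfold_sumset m A" "set xs \<subseteq> A" "sum_list xs = x"
  shows "m < length xs"
proof (rule ccontr)
  assume "\<not> m < length xs"
  then have "mfold_sumset (length xs) A \<subseteq> mfold_sumset m A"
    using assms(1) by (intro mfold_sumset_mono) auto
  moreover have "x \<in> mfold_sumset (length xs) A"
    using assms by (intro mfold_sumsetI) auto
  ultimately show False
    using assms(2) by blast
qed

lemma sum_list_bounds:
  assumes "\<forall>a\<in>set xs. 0 < a \<and> a < (l::int)" "xs \<noteq> []"
  shows "0 < sum_list xs \<and> sum_list xs < int (length xs) * l"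
  using assms
proof (induction xs)
  case (Cons a xs)
  then show ?case
    by (cases "xs = []") (auto simp: algebra_simps)
qed simp

text \<open>The summand \<open>l\<close> is used as often as possible, so the remaining summands admit no shortcut
  modulo \<open>l\<close>.\<close>

lemma extremal_representation:
  fixes A :: "int set"
  assumes A: "A \<subseteq> {0..l}" "0 \<in> A" "l \<in> A" and l: "l > 0"
    and x: "x \<notin> mfold_sumset m A" "x \<in> mfold_sumset (Suc m) A"
  obtains xs j where "sorted_wrt (\<ge>) xs" "set xs \<subseteq> A" "\<forall>a\<in>set xs. 0 < a \<and> a < l"
    "length xs + j = Suc m" "sum_list xs + int j * l = x"
    "\<And>u v w. xs = u @ v @ w \<Longrightarrow> v \<noteq> [] \<Longrightarrow> \<not> l dvd sum_list v"
    "\<And>u v w a. xs = u @ v @ w \<Longrightarrow> length v \<ge> 2 \<Longrightarrow> a \<in> A \<Longrightarrow> \<not> l dvd (sum_list v - a)"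
proof -
  \<comment> \<open>\<open>j\<close> counts the summands \<open>l\<close> that have been split off;
    \<open>xs\<close> may at first still contain \<open>0\<close> and \<open>l\<close>.\<close>
  define R where "R j xs \<longleftrightarrow> set xs \<subseteq> A \<and> length xs + j = Suc m \<and> sum_list xs + int j * l = x"
    for j xs
  have "\<exists>xs. R 0 xs"
    using x(2) by (auto simp: R_def mfold_sumset_iff_list)
  moreover have "\<forall>j. (\<exists>xs. R j xs) \<longrightarrow> j \<le> Suc m"
    by (auto simp: R_def)
  ultimately obtain j where "\<exists>xs. R j xs" and j_max: "\<And>i xs. R i xs \<Longrightarrow> i \<le> j"
    using Greatest_le_nat[of "\<lambda>j. \<exists>xs. R j xs" _ "Suc m"]
      GreatestI_nat[of "\<lambda>j. \<exists>xs. R j xs" 0 "Suc m"] by metis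
  then obtain ys where ys: "R j ys"
    by blast
  define xs where "xs = rev (sort ys)"
  have len: "length xs = length ys" and set: "set xs = set ys"
    by (auto simp: xs_def)
  have sum: "sum_list xs = sum_list ys"
    by (simp add: xs_def flip: sum_mset_sum_list)
  have R: "R j xs"
    using ys len set sum by (simp add: R_def)
  have sorted: "sorted_wrt (\<ge>) xs"
    by (simp add: xs_def sorted_wrt_rev)
  have short: "m < length zs + i" if "set zs \<subseteq> A" "sum_list zs + int i * l = x" for zs i
    using no_short_representation[OF A(2) x(1), of "zs @ replicate i l"] that A(3)
    by (auto simp: sum_list_replicate set_replicate_conv_if)
  have bounds: "0 < a \<and> a < l" if a: "a \<in> set xs" for a
  proof -
    obtain u w where uw: "xs = u @ a # w"
      using a by (meson split_list)
    have "a \<in> A"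
      using a R by (auto simp: R_def)
    \<comment> \<open>A summand \<open>0\<close> could be dropped, leaving only \<open>m\<close>
      summands; a summand \<open>l\<close> could be split off, raising \<open>j\<close>.\<close>
    have "a \<noteq> 0"
      using short[of "u @ w" j] R uw by (auto simp: R_def)
    moreover have "a \<noteq> l"
      using j_max[of "Suc j" "u @ w"] R uw by (auto simp: R_def algebra_simps)
    ultimately show ?thesis
      using \<open>a \<in> A\<close> A(1) by force
  qed
  show ?thesis
  proof (rule that[OF sorted])
    show "set xs \<subseteq> A" "length xs + j = Suc m" "sum_list xs + int j * l = x"
      using R by (auto simp: R_def)
    show "\<forall>a\<in>set xs. 0 < a \<and> a < l"
      using bounds by blast
  next
    fix u v w assume uvw: "xs = u @ v @ w" "v \<noteq> []"
    \<comment> \<open>If \<open>v\<close> sums to \<open>l * c\<close>, then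
      \<open>0 < c < length v\<close>, and \<open>c\<close> copies of \<open>l\<close> in place of
      \<open>v\<close> give a representation that is too short.\<close>
    show "\<not> l dvd sum_list v"
    proof
      assume "l dvd sum_list v"
      then obtain c where c: "sum_list v = l * c"
        by blast
      have b: "0 < l * c" "l * c < int (length v) * l"
        using sum_list_bounds[of v l] uvw bounds by (auto simp: c)
      then have "0 < c"
        using l by (simp add: zero_less_mult_iff)
      moreover have "c < int (length v)"
        using b(2) l by (simp add: mult.commute)
      ultimately have "m < length (u @ w) + (j + nat c)"
        using R uvw by (intro short) (auto simp: R_def c algebra_simps)
      then show False
        using R uvw(1) \<open>c < int (length v)\<close> \<open>0 < c\<close> by (auto simp: R_def)
    qed
  next
    fix u v w a assume uvw: "xs = u @ v @ w" "length v \<ge> 2" "a \<in> A"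
    \<comment> \<open>Now \<open>v\<close> is replaced by \<open>a\<close> and \<open>c\<close>
      copies of \<open>l\<close>. This is too short unless \<open>c = length v - 1\<close>; but
      then, as \<open>length v \<ge> 2\<close>, more copies of \<open>l\<close> are used, against
      the maximality of \<open>j\<close>.\<close>
    show "\<not> l dvd (sum_list v - a)"
    proof
      assume "l dvd sum_list v - a"
      then obtain c where c: "sum_list v = a + l * c"
        by (metis add_diff_cancel_left' diff_add_cancel dvdE add.commute)
      have "v \<noteq> []"
        using uvw(2) by auto
      then have b: "0 < sum_list v" "sum_list v < int (length v) * l"
        using sum_list_bounds[of v l] uvw bounds by auto
      have "0 \<le> a" "a \<le> l"
        using A(1) uvw(3) by auto
      have "l * (-1) < l * c"
        using b(1) \<open>a \<le> l\<close> c by simp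
      then have "- 1 < c"
        using l mult_less_cancel_left_pos by blast
      then have "0 \<le> c"
        by simp
      have "l * c < l * int (length v)"
        using b(2) \<open>0 \<le> a\<close> c by (simp add: mult.commute)
      then have "c < int (length v)"
        using l by simp
      have eq: "sum_list (a # u @ w) + int (j + nat c) * l = x"
        using R uvw \<open>0 \<le> c\<close> by (auto simp: R_def c algebra_simps)
      have "m < length (a # u @ w) + (j + nat c)"
        using R uvw eq by (intro short) (auto simp: R_def)
      then have "int (length v) - 1 \<le> c"
        using R uvw \<open>0 \<le> c\<close> by (auto simp: R_def)
      with \<open>c < int (length v)\<close> have "c = int (length v) - 1"
        by simp
      then have "R (j + nat c) (a # u @ w)"
        using R uvw eq by (auto simp: R_def)
      then have "j + nat c \<le> j"
        by (rule j_max)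
      then show False
        using \<open>c = int (length v) - 1\<close> uvw(2) by simp
    qed
  qed
qed

text \<open>Exchanging \<open>take i xs\<close> for the reflection of \<open>ys\<close> changes the sum by a multiple of \<open>l\<close>, which
  the \<open>j\<close> spare summands \<open>l\<close> can absorb.\<close>

lemma exchange_prefix:
  fixes A :: "int set"
  assumes "0 \<in> A" "l \<in> A" "x \<notin> mfold_sumset m A"
    and xs: "set xs \<subseteq> A" "length xs + j = Suc m" "sum_list xs + int j * l = x"
    and ys: "set ys \<subseteq> reflect l A" "sum_list (take i xs) + sum_list ys = int f * l"
    and len: "i \<le> length xs" "length ys \<le> f + j"
  shows "i \<le> f"
proof -
  \<comment> \<open>The reflected \<open>ys\<close> contribute
    \<open>length ys * l - sum_list ys\<close>, and the filler copies of \<open>l\<close> restore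
    the sum \<open>x\<close>. The new length is \<open>Suc m - i + f\<close>, which must exceed
    \<open>m\<close>.\<close>
  define zs where "zs = drop i xs @ map (\<lambda>b. l - b) ys @ replicate (f + j - length ys) l"
  have "set zs \<subseteq> A"
    using xs(1) ys(1) assms(2) by (auto simp: zs_def mem_reflect_iff dest: in_set_dropD split: if_splits)
  moreover have "sum_list (take i xs) + sum_list (drop i xs) = sum_list xs"
    by (metis append_take_drop_id sum_list_append)
  then have "sum_list zs = x"
    using xs(3) ys(2) len(2)
    by (simp add: zs_def sum_list_map_reflect sum_list_replicate of_nat_diff algebra_simps)
  ultimately have "m < length zs"
    by (rule no_short_representation[OF assms(1,3)])
  then show ?thesis
    using len xs(2) by (simp add: zs_def)
qed

lemma sum_list_ge_length_mult:
  "\<forall>a\<in>set xs. t \<le> a \<Longrightarrow> int (length xs) * t \<le> sum_list xs"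
  by (induction xs) (auto simp: algebra_simps)

lemma sum_list_le_length_mult:
  "\<forall>a\<in>set xs. a \<le> t \<Longrightarrow> sum_list xs \<le> int (length xs) * t"
  by (induction xs) (auto simp: algebra_simps)

text \<open>Comparing both parts of the list with the entry at the cut shows that the initial
  average dominates the total average; denominators are cleared.\<close>

lemma sum_list_take_descending:
  fixes xs :: "int list"
  assumes "sorted_wrt (\<ge>) xs" "i \<le> length xs"
  shows "int i * sum_list xs \<le> int (length xs) * sum_list (take i xs)"
proof (cases "i = length xs")
  case False
  define t where "t = xs ! i"
  define c where "c = length xs - i"
  have i: "i < length xs"
    using assms False by simp
  have 1: "int i * t \<le> sum_list (take i xs)"
  proof -
    have "\<forall>a\<in>set (take i xs). t \<le> a"
      using assms(1) i by (auto simp: t_def in_set_conv_nth sorted_wrt_iff_nth_less)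
    from sum_list_ge_length_mult[OF this] show ?thesis
      using i by simp
  qed
  have "a \<le> t" if "a \<in> set (drop i xs)" for a
  proof -
    from that obtain k where "k < length xs - i" "a = xs ! (i + k)"
      by (auto simp: set_conv_nth)
    then show ?thesis
      using assms(1) by (cases "k = 0") (auto simp: t_def sorted_wrt_iff_nth_less)
  qed
  then have 2: "sum_list (drop i xs) \<le> int c * t"
    using sum_list_le_length_mult[of "drop i xs" t] by (simp add: c_def)
  have 3: "sum_list xs = sum_list (take i xs) + sum_list (drop i xs)"
    by (metis append_take_drop_id sum_list_append)
  have 4: "int (length xs) = int i + int c"
    using i by (simp add: c_def)
  have "int i * sum_list (drop i xs) \<le> int i * (int c * t)"
    using 2 by (simp add: mult_left_mono)
  also have "\<dots> = int c * (int i * t)"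
    by simp
  also have "\<dots> \<le> int c * sum_list (take i xs)"
    using 1 by (simp add: mult_left_mono)
  finally show ?thesis
    by (simp add: 3 4 algebra_simps)
qed simp

text \<open>Brings differences of partial sums into the block form in which
  \<open>extremal_representation\<close> excludes divisibility by \<open>l\<close>.\<close>

lemma sum_list_take_diff:
  fixes xs :: "int list"
  assumes "i \<le> k" "k \<le> length xs"
  shows "\<exists>u v w. xs = u @ v @ w \<and> length v = k - i \<and> sum_list (take k xs) - sum_list (take i xs) = sum_list v"
proof (intro exI conjI)
  show "xs = take i xs @ take (k - i) (drop i xs) @ drop k xs"
    using assms by (metis append.assoc append_take_drop_id le_add_diff_inverse take_add)
  show "length (take (k - i) (drop i xs)) = k - i"
    using assms by simp
  show "sum_list (take k xs) - sum_list (take i xs) = sum_list (take (k - i) (drop i xs))"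
    using take_add[of i "k - i" xs] assms by simp
qed

text \<open>Counting residues modulo \<open>l\<close>: with \<open>e * l\<close> the sum of both
  truncated lists, the sets \<open>U\<close> and \<open>V\<close> satisfy
  \<open>card U + card V = m + e\<close>, share at most \<open>e\<close> elements, and lie among the
  \<open>l - card A + 1\<close> residues outside \<open>A\<close>.\<close>

lemma saturation_core:
  fixes A :: "int set"
  assumes A: "finite A" "A \<subseteq> {0..l}" "0 \<in> A" "l \<in> A" and l: "l > 0"
    and x: "x \<notin> mfold_sumset m A" "x \<in> mfold_sumset (Suc m) A"
    and x': "int m * l - x \<in> mfold_sumset (Suc m) (reflect l A)"
  shows "int m < l - int (card A) + 2"
proof -
  define B where "B = reflect l A"
  define y where "y = int m * l - x"
  have B: "B \<subseteq> {0..l}" "0 \<in> B" "l \<in> B"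
    using A by (auto simp: B_def reflect_def image_iff)
  have y: "y \<notin> mfold_sumset m B" "y \<in> mfold_sumset (Suc m) B"
    using x(1) x' by (auto simp: B_def y_def mfold_sumset_reflect)
  obtain xs j where xs: "sorted_wrt (\<ge>) xs" "set xs \<subseteq> A" "\<forall>a\<in>set xs. 0 < a \<and> a < l"
      "length xs + j = Suc m" "sum_list xs + int j * l = x"
    and xs0: "\<And>u v w. xs = u @ v @ w \<Longrightarrow> v \<noteq> [] \<Longrightarrow> \<not> l dvd sum_list v"
    and xs1: "\<And>u v w a. xs = u @ v @ w \<Longrightarrow> length v \<ge> 2 \<Longrightarrow> a \<in> A \<Longrightarrow> \<not> l dvd (sum_list v - a)"
    by (rule extremal_representation[OF A(2-4) l x]) blast
  obtain ys j' where ys: "sorted_wrt (\<ge>) ys" "set ys \<subseteq> B" "\<forall>a\<in>set ys. 0 < a \<and> a < l"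
      "length ys + j' = Suc m" "sum_list ys + int j' * l = y"
    and ys0: "\<And>u v w. ys = u @ v @ w \<Longrightarrow> v \<noteq> [] \<Longrightarrow> \<not> l dvd sum_list v"
    and ys1: "\<And>u v w a. ys = u @ v @ w \<Longrightarrow> length v \<ge> 2 \<Longrightarrow> a \<in> B \<Longrightarrow> \<not> l dvd (sum_list v - a)"
    by (rule extremal_representation[OF B l y]) blast
  define p where "p = length xs"
  define q where "q = length ys"
  define s where "s i = sum_list (take i xs)" for i
  define t where "t i = sum_list (take i ys)" for i
  have total: "s p + t q = (int m - int j - int j') * l"
    using xs(5) ys(5) by (simp add: s_def t_def p_def q_def y_def algebra_simps)
  have pos: "0 < sum_list (drop i zs)" if "\<forall>a\<in>set zs. 0 < a \<and> a < l" "i < length zs" for i zs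
    using sum_list_bounds[of "drop i zs" l] that by (auto dest: in_set_dropD)
  have pos_take: "0 < sum_list (take i zs)"
    if "\<forall>a\<in>set zs. 0 < a \<and> a < l" "0 < i" "i \<le> length zs" for i zs
  proof -
    have "take i zs \<noteq> []" "\<forall>a\<in>set (take i zs). 0 < a \<and> a < l"
      using that by (auto dest: in_set_takeD)
    then show ?thesis
      using sum_list_bounds by blast
  qed
  have split: "sum_list zs = sum_list (take i zs) + sum_list (drop i zs)" for i and zs :: "int list"
    by (metis append_take_drop_id sum_list_append)
  have s_pos: "0 < s p" if "0 < p"
    using pos[of xs 0] xs(3) that by (simp add: s_def p_def)
  have t_pos: "0 < t q" if "0 < q"
    using pos[of ys 0] ys(3) that by (simp add: t_def q_def)
  have "0 \<le> s p" "0 \<le> t q"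
    using s_pos t_pos by (cases "p = 0"; force simp: s_def t_def)+
  then have "0 \<le> (int m - int j - int j') * l"
    using total by simp
  then have "j + j' \<le> m"
    using l by (simp add: zero_le_mult_iff)
  then obtain e where m: "m = e + j + j'"
    by (metis add.assoc add.commute le_Suc_ex)
  have p: "p = e + j' + 1" and q: "q = e + j + 1"
    using xs(4) ys(4) m by (auto simp: p_def q_def)
  have total: "s p + t q = int e * l"
    using total m by simp
  have "e > 0"
    using total s_pos t_pos p q by (cases "e = 0") auto

  \<comment> \<open>Indices start at 2, because a partial sum of length one (negated, for
    \<open>V\<close>) does lie in \<open>A\<close> modulo \<open>l\<close>.\<close>
  define U where "U = (\<lambda>i. s i mod l) ` {2..p}"
  define V where "V = (\<lambda>i. (- t i) mod l) ` {2..q}"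
  have s_diff: "\<not> l dvd s k - s i" if "i < k" "k \<le> p" for i k
    using sum_list_take_diff[of i k xs] xs0 that unfolding s_def p_def
    by (metis less_imp_le_nat list.size(3) not_less_zero zero_less_diff)
  have t_diff: "\<not> l dvd t k - t i" if "i < k" "k \<le> q" for i k
    using sum_list_take_diff[of i k ys] ys0 that unfolding t_def q_def
    by (metis less_imp_le_nat list.size(3) not_less_zero zero_less_diff)
  have inj_s: "inj_on (\<lambda>i. s i mod l) {2..p}"
  proof (rule linorder_inj_onI)
    fix i k assume "i < k" "i \<in> {2..p}" "k \<in> {2..p}"
    then show "s i mod l \<noteq> s k mod l"
      using s_diff[of i k] by (metis atLeastAtMost_iff mod_eq_dvd_iff)
  qed auto
  have inj_t: "inj_on (\<lambda>i. (- t i) mod l) {2..q}"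
  proof (rule linorder_inj_onI)
    fix i k assume ik: "i < k" "i \<in> {2..q}" "k \<in> {2..q}"
    show "(- t i) mod l \<noteq> (- t k) mod l"
    proof
      assume "(- t i) mod l = (- t k) mod l"
      then have "l dvd t k - t i"
        by (simp add: mod_eq_dvd_iff)
      then show False
        using t_diff[of i k] ik by simp
    qed
  qed auto
  have "U \<subseteq> {0..<l} - (A - {l})"
  proof
    fix z assume "z \<in> U"
    then obtain i where i: "2 \<le> i" "i \<le> p" "z = s i mod l"
      by (auto simp: U_def)
    have "\<not> l dvd s i - a" if "a \<in> A" for a
      using xs1[of "[]" "take i xs" "drop i xs" a] i that by (simp add: s_def p_def)
    then have "z \<notin> A"
      unfolding i(3) by (metis dvd_minus_mod)
    then show "z \<in> {0..<l} - (A - {l})"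
      using i(3) l by auto
  qed
  moreover have "V \<subseteq> {0..<l} - (A - {l})"
  proof
    fix z assume "z \<in> V"
    then obtain i where i: "2 \<le> i" "i \<le> q" "z = (- t i) mod l"
      by (auto simp: V_def)
    have nd: "\<not> l dvd t i - b" if "b \<in> B" for b
      using ys1[of "[]" "take i ys" "drop i ys" b] i that by (simp add: t_def q_def)
    have "z \<notin> A"
    proof
      assume "z \<in> A"
      then have "l - z \<in> B"
        by (simp add: B_def mem_reflect_iff)
      moreover have "l dvd - t i - z"
        unfolding i(3) by (rule dvd_minus_mod)
      then have "l dvd t i - (l - z)"
        by (metis diff_diff_eq2 dvd_diff_commute dvd_triv_left dvd_diff dvd_refl minus_diff_eq
            add_uminus_conv_diff dvd_minus_iff diff_minus_eq_add add.commute)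
      ultimately show False
        using nd by blast
    qed
    then show "z \<in> {0..<l} - (A - {l})"
      using i(3) l by auto
  qed
  ultimately have "card (U \<union> V) \<le> card ({0..<l} - (A - {l}))"
    by (intro card_mono) auto
  \<comment> \<open>\<open>0\<close> and \<open>l\<close> are the same residue, so \<open>A\<close>
    occupies \<open>card A - 1\<close> residues.\<close>
  also have "int \<dots> = l - (int (card A) - 1)"
  proof -
    have sub: "A - {l} \<subseteq> {0..<l}"
      using A(2) by force
    have "card (A - {l}) \<le> card {0..<l}"
      using sub by (intro card_mono) auto
    moreover have "card A > 0"
      using A(1,3) by (auto simp: card_gt_0_iff)
    ultimately show ?thesis
      using A(1,4) l sub by (simp add: card_Diff_subset of_nat_diff)
  qed
  finally have UV: "int (card (U \<union> V)) \<le> l - int (card A) + 1"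
    by simp
  have cards: "card U = p - 1" "card V = q - 1"
    by (auto simp: U_def V_def card_image[OF inj_s] card_image[OF inj_t])
  have fin: "finite U" "finite V"
    by (auto simp: U_def V_def)

  define K where "K = {i \<in> {2..p}. s i mod l \<in> V}"
  have "U \<inter> V = (\<lambda>i. s i mod l) ` K"
    by (auto simp: K_def U_def)
  then have "card (U \<inter> V) = card K"
    by (auto simp: K_def intro!: card_image inj_on_subset[OF inj_s])
  \<comment> \<open>The index \<open>p\<close> has to be allowed, since \<open>s p + t q\<close> is
    a multiple of \<open>l\<close>; any other coincidence will satisfy
    \<open>i \<le> f < e\<close>.\<close>
  moreover have "K \<subseteq> insert p {1..e - 1}"
  proof
    fix i assume "i \<in> K"
    then obtain i' where i: "2 \<le> i" "i \<le> p" and i': "2 \<le> i'" "i' \<le> q"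
      and "s i mod l = (- t i') mod l"
      by (auto simp: K_def V_def)
    then have "l dvd s i + t i'"
      by (simp add: mod_eq_dvd_iff)
    then obtain c where c: "s i + t i' = l * c"
      by blast
    have "0 < s i" "0 < t i'"
      using pos_take[OF xs(3), of i] pos_take[OF ys(3), of i'] i i'
      by (auto simp: s_def t_def p_def q_def)
    then have "0 < c"
      using c l by (metis add_pos_pos zero_less_mult_pos)
    define f where "f = nat c"
    have f: "s i + t i' = int f * l" "f > 0"
      using c \<open>0 < c\<close> by (auto simp: f_def mult.commute)
    \<comment> \<open>The exchange is tried in the representation of \<open>x\<close> and then of
      \<open>y\<close>; each needs the incoming segment to have length at most \<open>f\<close> plus
      the spare copies of \<open>l\<close>.\<close>
    have swap1: "i \<le> f" if "i' \<le> f + j"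
      using exchange_prefix[OF A(3,4) x(1) xs(2,4,5), of "take i' ys" i f] i i' f(1) that ys(2)
      by (auto simp: s_def t_def B_def p_def q_def dest!: in_set_takeD)
    have swap2: "i' \<le> f" if "i \<le> f + j'"
      using exchange_prefix[OF B(2,3) y(1) ys(2,4,5), of "take i xs" i' f] i i' f(1) that xs(2)
      by (auto simp: s_def t_def B_def p_def q_def add.commute dest!: in_set_takeD)
    show "i \<in> insert p {1..e - 1}"
    proof (cases "i = p")
      case False
      have "s i < s p"
        using pos[of xs i] split[of xs i] xs(3) False i by (simp add: s_def p_def)
      moreover have "t i' \<le> t q"
        using pos[of ys i'] split[of ys i'] ys(3) i' by (cases "i' = q") (auto simp: t_def q_def)
      ultimately have "int f * l < int e * l"
        using f(1) total by linarith
      then have "f < e"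
        using l by simp
      \<comment> \<open>Otherwise neither exchange is admissible, so both segments are long. By
        averaging, each then carries more than the fraction \<open>f / e\<close> of its whole list,
        and together they exceed \<open>f * l\<close>.\<close>
      have "i \<le> f"
      proof (rule ccontr)
        assume "\<not> i \<le> f"
        then have "f + j < i'" "f + j' < i"
          using swap1 swap2 by linarith+
        \<comment> \<open>Since \<open>f < e\<close>, adding the same positive number to numerator
          and denominator enlarges \<open>f / e\<close>.\<close>
        have *: "int f * int p < int e * int i" "int f * int q < int e * int i'"
        proof -
          have "int f * (int e + int k + 1) < int e * (int f + int k + 1)" for k :: nat
            using \<open>f < e\<close> mult_strict_right_mono[of "int f" "int e" "int k + 1"]
            by (simp add: algebra_simps)
          moreover have "int e * (int f + int j' + 1) \<le> int e * int i"
              "int e * (int f + int j + 1) \<le> int e * int i'"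
            using \<open>f + j < i'\<close> \<open>f + j' < i\<close> by (auto intro!: mult_left_mono)
          ultimately show "int f * int p < int e * int i" "int f * int q < int e * int i'"
            unfolding p q by (smt (verit) of_nat_1 of_nat_add)+
        qed
        have avg: "int i * s p \<le> int p * s i" "int i' * t q \<le> int q * t i'"
          using sum_list_take_descending[OF xs(1), of i] sum_list_take_descending[OF ys(1), of i'] i i'
          by (auto simp: s_def t_def p_def q_def)
        have main: "int f * S < int e * S'"
          if "int f * int P < int e * int I" "int I * S \<le> int P * S'" "0 < S" for P I :: nat and S S' :: int
        proof -
          have "int P * (int f * S) < int e * int I * S"
            using mult_strict_right_mono[OF that(1,3)] by (simp add: mult_ac)
          also have "\<dots> \<le> int e * (int P * S')"
            using mult_left_mono[OF that(2), of "int e"] by (simp add: mult_ac)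
          finally have "int P * (int f * S) < int P * (int e * S')"
            by (simp add: mult_ac)
          then show ?thesis
            by (simp add: mult_less_cancel_left)
        qed
        have "int f * (s p + t q) < int e * (s i + t i')"
          using main[OF *(1) avg(1)] main[OF *(2) avg(2)] s_pos t_pos p q by (simp add: algebra_simps)
        then show False
          by (simp add: total f(1))
      qed
      then show ?thesis
        using \<open>f < e\<close> i by auto
    qed simp
  qed
  then have "card K \<le> card (insert p {1..e - 1})"
    by (intro card_mono) auto
  then have "card K \<le> e"
    using card_insert_le_m1[of e "{1..e - 1}" p] \<open>e > 0\<close> by simp
  moreover have "card U + card V = card (U \<union> V) + card (U \<inter> V)"
    using fin by (rule card_Un_Int)
  ultimately show ?thesis
    using UV cards p q m by linarith
qed

text \<open>The level \<open>m\<close> is raised to the last one at which \<open>x\<close> is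
  missing, and then once more to the last one at which the reflected element is missing. The second
  raise adds copies of \<open>l\<close> to \<open>x\<close>, which preserves the first condition, so
  \<open>saturation_core\<close> applies.\<close>

theorem sumset_saturated:
  fixes A :: "int set"
  assumes A: "finite A" "A \<subseteq> {0..l}" "0 \<in> A" "l \<in> A" and l: "l > 0"
    and m: "int m \<ge> l - int (card A) + 2"
    and x: "x \<in> mfold_sumset w A" "int m * l - x \<in> mfold_sumset w' (reflect l A)"
  shows "x \<in> mfold_sumset m A"
proof (rule ccontr)
  assume bad: "x \<notin> mfold_sumset m A"
  have step: "\<exists>m1\<ge>m0. x0 \<notin> mfold_sumset m1 C \<and> x0 \<in> mfold_sumset (Suc m1) C"
    if "x0 \<notin> mfold_sumset m0 C" "x0 \<in> mfold_sumset w0 C" "0 \<in> C" for x0 m0 w0 and C :: "int set"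
  proof -
    define k where "k = (LEAST k. x0 \<in> mfold_sumset k C)"
    have k: "x0 \<in> mfold_sumset k C"
      unfolding k_def using that(2) by (rule LeastI)
    have "m0 < k"
      using that(1,3) k mfold_sumset_mono[of C k m0] by (meson not_le subsetD)
    moreover have "x0 \<notin> mfold_sumset (k - 1) C"
      using not_less_Least[of "k - 1" "\<lambda>k. x0 \<in> mfold_sumset k C"] \<open>m0 < k\<close> by (simp add: k_def)
    ultimately show ?thesis
      using k by (intro exI[of _ "k - 1"]) auto
  qed
  have refl0: "0 \<in> reflect l A"
    using A(4) by (simp add: mem_reflect_iff)
  obtain m1 where m1: "m1 \<ge> m" "x \<notin> mfold_sumset m1 A" "x \<in> mfold_sumset (Suc m1) A"
    using step[OF bad x(1) A(3)] by blast
  define y where "y = int m1 * l - x"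
  have y1: "y \<notin> mfold_sumset m1 (reflect l A)"
    using m1(2) by (simp add: y_def mfold_sumset_reflect)
  have "y \<in> mfold_sumset (w' + (m1 - m)) (reflect l A)"
  proof -
    obtain ys where ys: "set ys \<subseteq> reflect l A" "length ys = w'" "sum_list ys = int m * l - x"
      using x(2) by (auto simp: mfold_sumset_iff_list)
    have "l \<in> reflect l A"
      using A(3) by (simp add: mem_reflect_iff)
    then show ?thesis
      using ys m1(1) by (intro mfold_sumsetI[of "ys @ replicate (m1 - m) l"])
        (auto simp: sum_list_replicate y_def of_nat_diff algebra_simps split: if_splits)
  qed
  then obtain m2 where m2: "m2 \<ge> m1" "y \<notin> mfold_sumset m2 (reflect l A)"
      "y \<in> mfold_sumset (Suc m2) (reflect l A)"
    using step[OF y1 _ refl0] by blast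
  \<comment> \<open>In terms of \<open>x\<close> this is \<open>x + (m2 - m1) * l\<close>.\<close>
  define z where "z = int m2 * l - y"
  have "z \<notin> mfold_sumset m2 A"
    using m2(2) by (simp add: z_def mfold_sumset_reflect)
  moreover have "z \<in> mfold_sumset (Suc m2) A"
  proof -
    obtain xs where xs: "set xs \<subseteq> A" "length xs = Suc m1" "sum_list xs = x"
      using m1(3) by (auto simp: mfold_sumset_iff_list)
    then show ?thesis
      using A(4) m2(1) by (intro mfold_sumsetI[of "xs @ replicate (m2 - m1) l"])
        (auto simp: sum_list_replicate y_def z_def of_nat_diff algebra_simps split: if_splits)
  qed
  moreover have "int m2 * l - z \<in> mfold_sumset (Suc m2) (reflect l A)"
    using m2(3) by (simp add: z_def)
  ultimately have "int m2 < l - int (card A) + 2"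
    by (rule saturation_core[OF A l])
  then show False
    using m m1(1) m2(1) by linarith
qed

section \<open>Periodic sets of integers\<close>

text \<open>Subsets of the cyclic group of order \<open>l\<close> are represented by \<open>l\<close>-periodic sets of integers, and
  their cardinality by \<open>dens l\<close>.\<close>

definition periodic :: "int \<Rightarrow> int set \<Rightarrow> bool" where
  "periodic l X \<longleftrightarrow> (\<forall>x. x + l \<in> X \<longleftrightarrow> x \<in> X)"

definition dens :: "int \<Rightarrow> int set \<Rightarrow> nat" where
  "dens l X = card (X \<inter> {0..<l})"

lemma periodic_mult:
  assumes "periodic l X"
  shows "x + l * k \<in> X \<longleftrightarrow> x \<in> X"
proof -
  have "x + l * int n \<in> X \<longleftrightarrow> x \<in> X" for x n
  proof (induction n)
    case (Suc n)
    have "x + l * int (Suc n) = (x + l * int n) + l"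
      by (simp add: algebra_simps)
    then show ?case
      using Suc assms unfolding periodic_def by metis
  qed simp
  from this[of x "nat k"] this[of "x + l * k" "nat (- k)"] show ?thesis
    by (cases "k \<ge> 0") auto
qed

lemma periodic_cong:
  assumes "periodic l X" "l dvd x - y"
  shows "x \<in> X \<longleftrightarrow> y \<in> X"
proof -
  obtain k where "x - y = l * k"
    using assms(2) by blast
  then have "x = y + l * k"
    by simp
  then show ?thesis
    using periodic_mult[OF assms(1)] by simp
qed

lemma periodicI:
  assumes "\<And>x y. l dvd x - y \<Longrightarrow> y \<in> X \<Longrightarrow> x \<in> X"
  shows "periodic l X"
  using assms unfolding periodic_def
  by (metis add_diff_cancel_left' diff_add_cancel diff_diff_eq2 diff_self dvd_minus_iff dvd_refl minus_diff_eq)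

lemma periodic_mod: "periodic l X \<Longrightarrow> x mod l \<in> X \<longleftrightarrow> x \<in> X"
  by (metis mod_eq_dvd_iff mod_mod_trivial periodic_cong)

lemma periodic_dvd: "periodic d X \<Longrightarrow> d dvd l \<Longrightarrow> periodic l X"
  by (rule periodicI) (metis dvd_trans periodic_cong)

lemma periodic_Compl: "periodic l X \<Longrightarrow> periodic l (- X)"
  and periodic_Int: "periodic l X \<Longrightarrow> periodic l Y \<Longrightarrow> periodic l (X \<inter> Y)"
  and periodic_Un: "periodic l X \<Longrightarrow> periodic l Y \<Longrightarrow> periodic l (X \<union> Y)"
  and periodic_Diff: "periodic l X \<Longrightarrow> periodic l Y \<Longrightarrow> periodic l (X - Y)"
  by (auto simp: periodic_def)

lemma periodic_plus:
  assumes "periodic l X"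
  shows "periodic l (X + Y)"
proof (rule periodicI)
  fix x y assume "l dvd x - y" "y \<in> X + Y"
  then obtain u v where uv: "u \<in> X" "v \<in> Y" "y = u + v"
    by (auto elim: set_plus_elim)
  have "u + (x - y) \<in> X"
    using periodic_cong[OF assms, of "u + (x - y)" u] uv(1) \<open>l dvd x - y\<close> by simp
  then have "(u + (x - y)) + v \<in> X + Y"
    using uv(2) by (rule set_plus_intro)
  then show "x \<in> X + Y"
    using uv(3) by simp
qed

lemma periodic_shift:
  assumes "periodic l X"
  shows "periodic l {x. x - g \<in> X}"
proof (rule periodicI)
  fix x y assume "l dvd x - y" "y \<in> {x. x - g \<in> X}"
  then show "x \<in> {x. x - g \<in> X}"
    using periodic_cong[OF assms, of "x - g" "y - g"] by simp
qed

lemma periodic_reflection: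
  assumes "periodic l X"
  shows "periodic l {x. g - x \<in> X}"
proof (rule periodicI)
  fix x y assume "l dvd x - y" "y \<in> {x. g - x \<in> X}"
  then show "x \<in> {x. g - x \<in> X}"
    using periodic_cong[OF assms, of "g - x" "g - y"] by (simp add: dvd_diff_commute)
qed

lemma dens_Un_Int: "dens l X + dens l Y = dens l (X \<union> Y) + dens l (X \<inter> Y)"
  unfolding dens_def by (subst card_Un_Int) (auto intro!: arg_cong2[of _ _ _ _ "(+)"] arg_cong[of _ _ card])

lemma dens_mono: "X \<subseteq> Y \<Longrightarrow> dens l X \<le> dens l Y"
  by (auto simp: dens_def intro!: card_mono)

lemma dens_le: "int (dens l X) \<le> l" if "l > 0"
  using card_mono[of "{0..<l}" "X \<inter> {0..<l}"] that by (simp add: dens_def)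

lemma dens_UNIV: "l > 0 \<Longrightarrow> int (dens l UNIV) = l"
  by (simp add: dens_def)

lemma dens_empty [simp]: "dens l {} = 0"
  by (simp add: dens_def)

lemma dens_Diff: "dens l X = dens l (X - Y) + dens l (X \<inter> Y)"
proof -
  have "(X - Y) \<union> (X \<inter> Y) = X" "(X - Y) \<inter> (X \<inter> Y) = {}"
    by auto
  then show ?thesis
    using dens_Un_Int[of l "X - Y" "X \<inter> Y"] by simp
qed

lemma dens_Compl: "l > 0 \<Longrightarrow> int (dens l (- X)) = l - int (dens l X)"
  using dens_Un_Int[of l X "- X"] dens_UNIV[of l] by simp

text \<open>The values of \<open>f\<close> are reduced modulo \<open>l\<close>, so \<open>f\<close>
  need only be injective on residues and need not preserve \<open>{0..<l}\<close>.\<close>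

lemma dens_le_by_map:
  assumes "l > 0" "periodic l Y"
    and "\<And>x. x \<in> X \<Longrightarrow> f x \<in> Y"
    and "\<And>x y. x \<in> X \<Longrightarrow> y \<in> X \<Longrightarrow> l dvd f x - f y \<Longrightarrow> l dvd x - y"
  shows "dens l X \<le> dens l Y"
  unfolding dens_def
proof (rule card_inj_on_le[where f = "\<lambda>x. f x mod l"])
  show "inj_on (\<lambda>x. f x mod l) (X \<inter> {0..<l})"
  proof (rule inj_onI)
    fix x y assume xy: "x \<in> X \<inter> {0..<l}" "y \<in> X \<inter> {0..<l}" "f x mod l = f y mod l"
    then have "l dvd x - y"
      using assms(4)[of x y] by (simp add: mod_eq_dvd_iff)
    then have "x mod l = y mod l"
      by (simp add: mod_eq_dvd_iff)
    then show "x = y"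
      using xy by simp
  qed
  show "(\<lambda>x. f x mod l) ` (X \<inter> {0..<l}) \<subseteq> Y \<inter> {0..<l}"
    using assms(1-3) by (auto simp: periodic_mod)
qed simp

lemma dens_shift:
  assumes "l > 0" "periodic l X"
  shows "dens l {x. x - g \<in> X} = dens l X"
proof (rule antisym)
  show "dens l {x. x - g \<in> X} \<le> dens l X"
    by (rule dens_le_by_map[where f = "\<lambda>x. x - g"]) (use assms in auto)
  show "dens l X \<le> dens l {x. x - g \<in> X}"
    by (rule dens_le_by_map[where f = "\<lambda>x. x + g"]) (use assms periodic_shift in auto)
qed

lemma dens_reflection:
  assumes "l > 0" "periodic l X"
  shows "dens l {x. g - x \<in> X} = dens l X"
proof (rule antisym)
  show "dens l {x. g - x \<in> X} \<le> dens l X"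
    by (rule dens_le_by_map[where f = "\<lambda>x. g - x"]) (use assms in \<open>auto simp: dvd_diff_commute\<close>)
  show "dens l X \<le> dens l {x. g - x \<in> X}"
    by (rule dens_le_by_map[where f = "\<lambda>x. g - x"])
      (use assms periodic_reflection in \<open>auto simp: dvd_diff_commute\<close>)
qed

lemma dens_pos:
  assumes "l > 0" "periodic l X" "X \<noteq> {}"
  shows "dens l X > 0"
proof -
  obtain x where "x \<in> X"
    using assms(3) by blast
  then have "x mod l \<in> X \<inter> {0..<l}"
    using assms by (simp add: periodic_mod)
  then show ?thesis
    unfolding dens_def by (subst card_gt_0_iff) auto
qed

lemma dens_subset_eq:
  assumes "l > 0" "periodic l X" "periodic l Y" "X \<subseteq> Y" "dens l Y \<le> dens l X"
  shows "X = Y"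
proof (rule ccontr)
  assume "X \<noteq> Y"
  then have "dens l (Y - X) > 0"
    using assms by (intro dens_pos periodic_Diff) auto
  moreover have "Y \<inter> X = X"
    using assms(4) by blast
  ultimately show False
    using dens_Diff[of l Y X] assms(5) by simp
qed

text \<open>Periodicity supplies inverses, as \<open>- x\<close> is congruent to
  \<open>(l - 1) * x\<close>; the generator is the least positive element.\<close>

lemma closed_periodic_multiples:
  fixes H :: "int set"
  assumes "l > 0" "periodic l H" "0 \<in> H" and closed: "\<And>x y. x \<in> H \<Longrightarrow> y \<in> H \<Longrightarrow> x + y \<in> H"
  obtains d where "d > 0" "d dvd l" "H = {x. d dvd x}"
proof -
  have mult: "int k * x \<in> H" if "x \<in> H" for k x
    using that assms(3) closed by (induction k) (auto simp: algebra_simps)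
  have neg: "- x \<in> H" if "x \<in> H" for x
  proof -
    have "int (nat (l - 1)) * x + l * (- x) \<in> H"
      using periodic_mult[OF assms(2)] mult[OF that] by blast
    then show ?thesis
      using assms(1) by (simp add: algebra_simps)
  qed
  have "l \<in> H"
    using assms(2,3) by (metis add_0 periodic_def)
  then have ex: "\<exists>k::nat. k > 0 \<and> int k \<in> H"
    using assms(1) by (intro exI[of _ "nat l"]) auto
  define k where "k = (LEAST k::nat. k > 0 \<and> int k \<in> H)"
  have k: "k > 0" "int k \<in> H"
    using LeastI_ex[OF ex] by (auto simp: k_def)
  have k_min: "k \<le> i" if "i > 0" "int i \<in> H" for i :: nat
    unfolding k_def using that by (intro Least_le) auto
  have *: "int k * c \<in> H" for c
    using mult[OF k(2), of "nat c"] neg[OF mult[OF k(2), of "nat (- c)"]]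
    by (cases "c \<ge> 0") (auto simp: mult.commute)
  have "int k dvd x" if "x \<in> H" for x
  proof -
    have "x mod int k = x + int k * (- (x div int k))"
      by (simp add: minus_mult_div_eq_mod)
    then have "x mod int k \<in> H"
      using closed[OF that *[of "- (x div int k)"]] by simp
    moreover have "0 \<le> x mod int k" "x mod int k < int k"
      using k(1) by auto
    ultimately have "x mod int k = 0"
      using k_min[of "nat (x mod int k)"] by (cases "x mod int k = 0") auto
    then show ?thesis
      by auto
  qed
  then have "H = {x. int k dvd x}"
    using * by (auto elim!: dvdE)
  then show ?thesis
    using that[of "int k"] k(1) \<open>l \<in> H\<close> by auto
qed

text \<open>The translations mapping \<open>X\<close> into itself form a subgroup containing
  \<open>A\<close>, hence all of the integers by the gcd condition; they are applied to
  \<open>0\<close>.\<close>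

lemma closed_under_generators:
  assumes "l > 0" "periodic l X" "0 \<in> X" "X + A \<subseteq> X" "Gcd A = (1::int)"
  shows "X = UNIV"
proof -
  define K where "K = {g. \<forall>x\<in>X. x + g \<in> X}"
  have "periodic l K"
  proof (rule periodicI)
    fix x y assume xy: "l dvd x - y" "y \<in> K"
    have "z + x \<in> X \<longleftrightarrow> z + y \<in> X" for z
      using xy(1) by (intro periodic_cong[OF assms(2)]) simp
    then show "x \<in> K"
      using xy(2) by (simp add: K_def)
  qed
  moreover have "0 \<in> K" "\<And>x y. x \<in> K \<Longrightarrow> y \<in> K \<Longrightarrow> x + y \<in> K"
    by (auto simp: K_def add.assoc[symmetric])
  ultimately obtain d where d: "d > 0" "K = {x. d dvd x}"
    using closed_periodic_multiples[OF assms(1)] by metis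
  have "a \<in> K" if "a \<in> A" for a
    using assms(4) that unfolding K_def by (auto intro: set_plus_intro)
  then have "d dvd Gcd A"
    using d(2) by (auto intro: Gcd_greatest)
  then have "K = UNIV"
    using assms(5) d by (metis UNIV_eq_I mem_Collect_eq unit_imp_dvd)
  then have "0 + g \<in> X" for g
    using assms(3) unfolding K_def by blast
  then show ?thesis
    by auto
qed

section \<open>An isoperimetric subgroup\<close>

lemma dens_plus_ge:
  assumes "l > 0" "periodic l T" "A \<noteq> {}"
  shows "dens l T \<le> dens l (T + A)"
proof -
  obtain a where a: "a \<in> A"
    using assms(3) by blast
  show ?thesis
    by (rule dens_le_by_map[where f = "\<lambda>x. x + a"])
      (use assms a periodic_plus in \<open>auto intro: set_plus_intro\<close>)
qed

text \<open>Hamidoune's method: a smallest set \<open>X\<close> minimising \<open>dens l (X + A) - dens l X\<close> meets each of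
  its translates in the empty set or in \<open>X\<close>, so its translate through \<open>0\<close> is a subgroup.\<close>

lemma isoperimetric_subgroup:
  fixes A :: "int set"
  assumes l: "l > 0" and "A \<noteq> {}" and T0: "periodic l T0" "T0 \<noteq> {}" "T0 + A \<noteq> UNIV"
  obtains d where "d > 0" "d dvd l" "{x. d dvd x} + A \<noteq> UNIV"
    "\<And>T. periodic l T \<Longrightarrow> T \<noteq> {} \<Longrightarrow> T + A \<noteq> UNIV \<Longrightarrow>
       dens l T + dens l ({x. d dvd x} + A) \<le> dens l (T + A) + dens l {x. d dvd x}"
proof -
  \<comment> \<open>\<open>F\<close> describes the competitors and \<open>b\<close> their boundary
    size; by \<open>dens_plus_ge\<close> the subtraction in \<open>b\<close> is never
    truncated.\<close>
  define F where "F T \<longleftrightarrow> periodic l T \<and> T \<noteq> {} \<and> T + A \<noteq> UNIV" for T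
  define b where "b T = dens l (T + A) - dens l T" for T
  have b: "dens l (T + A) = dens l T + b T" if "F T" for T
    using dens_plus_ge[OF l _ assms(2)] that by (simp add: b_def F_def)
  obtain X0 where X0: "F X0" "\<And>T. F T \<Longrightarrow> b X0 \<le> b T"
    using ex_has_least_nat[of F T0 b] T0 by (auto simp: F_def)
  obtain X where X: "F X" "b X = b X0" and X_min: "\<And>T. F T \<Longrightarrow> b T = b X0 \<Longrightarrow> dens l X \<le> dens l T"
    using ex_has_least_nat[of "\<lambda>T. F T \<and> b T = b X0" X0 "dens l"] X0 by auto
  have min: "b X \<le> b T" if "F T" for T
    using X0(2)[OF that] X(2) by simp

  \<comment> \<open>Duality: the negated complement \<open>Y\<close> of \<open>X + A\<close> is a
    competitor with boundary no larger than that of \<open>X\<close>, so \<open>X\<close>, being a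
    smallest minimiser, is no larger than \<open>Y\<close>.\<close>
  have room: "int (dens l X) \<le> l - int (dens l (X + A))"
  proof -
    define Y where "Y = {x. 0 - x \<in> - (X + A)}"
    have perXA: "periodic l (X + A)"
      using X(1) by (auto simp: F_def intro: periodic_plus)
    have perY: "periodic l Y"
      unfolding Y_def by (intro periodic_reflection periodic_Compl perXA)
    have dY: "int (dens l Y) = l - int (dens l (X + A))"
      using dens_reflection[OF l periodic_Compl[OF perXA], of 0] dens_Compl[OF l] by (simp add: Y_def)
    have YA: "Y + A \<subseteq> {x. 0 - x \<in> - X}"
      by (auto simp: Y_def elim!: set_plus_elim) (metis add.commute diff_add_cancel minus_add_distrib set_plus_intro uminus_add_conv_diff)
    have "dens l (Y + A) \<le> dens l (- X)"
      using dens_mono[OF YA, of l] dens_reflection[OF l periodic_Compl, of X 0] X(1) by (simp add: F_def)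
    then have dYA: "int (dens l (Y + A)) \<le> l - int (dens l X)"
      using dens_Compl[OF l, of X] by simp
    have "Y \<noteq> {}"
    proof -
      obtain z where "z \<notin> X + A"
        using X(1) by (auto simp: F_def)
      then have "- z \<in> Y"
        by (simp add: Y_def)
      then show ?thesis
        by blast
    qed
    moreover have "Y + A \<noteq> UNIV"
    proof -
      obtain z where "z \<in> X"
        using X(1) by (auto simp: F_def)
      then have "- z \<notin> Y + A"
        using YA by auto
      then show ?thesis
        by blast
    qed
    ultimately have FY: "F Y"
      using perY by (simp add: F_def)
    have "b Y \<le> b X"
      using b[OF FY] b[OF X(1)] dY dYA by linarith
    then have "b Y = b X0"
      using min[OF FY] X(2) by simp
    from X_min[OF FY this] show ?thesis
      using dY by simp
  qed

  \<comment> \<open>Submodularity: a proper nonempty intersection would have a strictly larger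
    boundary, forcing a strictly smaller one on \<open>X \<union> Y\<close>. By \<open>room\<close>,
    the union is still a competitor, so this is impossible.\<close>
  have inter: "X \<inter> Y = X" if FY: "F Y" and eq: "dens l Y = dens l X" "dens l (Y + A) = dens l (X + A)"
    and ne: "X \<inter> Y \<noteq> {}" for Y
  proof (rule ccontr)
    assume neq: "X \<inter> Y \<noteq> X"
    have per: "periodic l X" "periodic l Y"
      using X(1) FY by (auto simp: F_def)
    have "(X \<inter> Y) + A \<subseteq> X + A"
      by (auto simp: set_plus_def)
    then have FI: "F (X \<inter> Y)"
      using X(1) ne per periodic_Int unfolding F_def by blast
    have small: "dens l (X \<inter> Y) < dens l X"
      using dens_subset_eq[OF l, of "X \<inter> Y" X] per neq periodic_Int by fastforce
    then have "b (X \<inter> Y) \<noteq> b X0"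
      using X_min[OF FI] by auto
    then have bI: "b X < b (X \<inter> Y)"
      using min[OF FI] X(2) by simp
    have "dens l ((X \<inter> Y) + A) \<le> dens l ((X + A) \<inter> (Y + A))"
      by (intro dens_mono) (auto simp: set_plus_def)
    moreover have "(X \<union> Y) + A = (X + A) \<union> (Y + A)"
      by (auto simp: set_plus_def)
    ultimately have sub: "dens l ((X \<union> Y) + A) + dens l ((X \<inter> Y) + A) \<le> dens l (X + A) + dens l (Y + A)"
      using dens_Un_Int[of l "X + A" "Y + A"] by simp
    have un: "dens l (X \<union> Y) + dens l (X \<inter> Y) = dens l X + dens l Y"
      using dens_Un_Int[of l X Y] by simp
    have pos: "dens l (X \<inter> Y) > 0"
      using dens_pos[OF l periodic_Int[OF per] ne] .
    have lt: "dens l ((X \<union> Y) + A) < dens l (X \<union> Y) + b X"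
      using sub un bI b[OF FI] b[OF X(1)] eq by linarith
    have "int (dens l ((X \<union> Y) + A)) < l"
      using lt un pos room b[OF X(1)] eq by linarith
    then have "(X \<union> Y) + A \<noteq> UNIV"
      using dens_UNIV[OF l] by auto
    then have FU: "F (X \<union> Y)"
      using per periodic_Un ne by (auto simp: F_def)
    show False
      using min[OF FU] b[OF FU] lt by simp
  qed

  obtain x0 where x0: "x0 \<in> X"
    using X(1) by (auto simp: F_def)
  define H where "H = {x. x - (- x0) \<in> X}"
  have perX: "periodic l X"
    using X(1) by (simp add: F_def)
  have plus_shift: "{x. x - g \<in> X} + A = {x. x - g \<in> X + A}" for g
  proof (intro set_eqI iffI)
    fix x assume "x \<in> {x. x - g \<in> X} + A"
    then obtain u a where "u - g \<in> X" "a \<in> A" "x = u + a"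
      by (auto elim: set_plus_elim)
    moreover have "u + a - g = (u - g) + a"
      by simp
    ultimately show "x \<in> {x. x - g \<in> X + A}"
      by (metis mem_Collect_eq set_plus_intro)
  next
    fix x assume "x \<in> {x. x - g \<in> X + A}"
    then obtain u a where ua: "u \<in> X" "a \<in> A" "x - g = u + a"
      by (auto elim: set_plus_elim)
    have "(u + g) + a \<in> {x. x - g \<in> X} + A"
      using ua by (intro set_plus_intro) auto
    then show "x \<in> {x. x - g \<in> X} + A"
      using ua(3) by (simp add: algebra_simps)
  qed
  have perXA: "periodic l (X + A)"
    using perX by (rule periodic_plus)
  have shift_eq: "dens l {x. x - g \<in> X} = dens l X" "dens l ({x. x - g \<in> X} + A) = dens l (X + A)" for g
    unfolding plus_shift using dens_shift[OF l] perX perXA by auto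
  have F_shift: "F {x. x - g \<in> X}" for g
    unfolding F_def
  proof (intro conjI)
    show "periodic l {x. x - g \<in> X}"
      by (rule periodic_shift[OF perX])
    have "x0 + g \<in> {x. x - g \<in> X}"
      using x0 by simp
    then show "{x. x - g \<in> X} \<noteq> {}"
      by blast
    obtain z where "z \<notin> X + A"
      using X(1) by (auto simp: F_def)
    then have "z + g \<notin> {x. x - g \<in> X} + A"
      unfolding plus_shift by simp
    then show "{x. x - g \<in> X} + A \<noteq> UNIV"
      by blast
  qed
  \<comment> \<open>If \<open>g\<close> moves one point of \<open>X\<close> into \<open>X\<close>,
    then \<open>X\<close> meets its translate by \<open>- g\<close> and so is contained in
    it.\<close>
  have trans: "x + g \<in> X" if "x \<in> X" "x1 \<in> X" "x1 + g \<in> X" for x x1 g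
  proof -
    have "x1 \<in> X \<inter> {x. x - (- g) \<in> X}"
      using that by simp
    then have "X \<inter> {x. x - (- g) \<in> X} = X"
      using inter[OF F_shift shift_eq, of "- g"] by blast
    then have "x \<in> {x. x - (- g) \<in> X}"
      using that(1) by blast
    then show ?thesis
      by simp
  qed
  have "x + y \<in> H" if "x \<in> H" "y \<in> H" for x y
    using trans[of "x + x0" x0 y] that x0 by (simp add: H_def algebra_simps)
  moreover have "periodic l H"
    unfolding H_def by (rule periodic_shift[OF perX])
  moreover have "0 \<in> H"
    using x0 by (simp add: H_def)
  ultimately obtain d where d: "d > 0" "d dvd l" "H = {x. d dvd x}"
    using closed_periodic_multiples[OF l] by metis
  show ?thesis
  proof (rule that[OF d(1,2)])
    show "{x. d dvd x} + A \<noteq> UNIV"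
      using F_shift[of "- x0"] by (simp add: F_def H_def d(3)[symmetric])
    fix T assume "periodic l T" "T \<noteq> {}" "T + A \<noteq> UNIV"
    then have "F T"
      by (simp add: F_def)
    then show "dens l T + dens l ({x. d dvd x} + A) \<le> dens l (T + A) + dens l {x. d dvd x}"
      using min[of T] b[of T] b[OF X(1)] shift_eq[of "- x0"] by (simp add: H_def d(3)[symmetric])
  qed
qed

section \<open>Growth of multiple sumsets\<close>

text \<open>The translates \<open>Min X + Y\<close> and \<open>X + Max Y\<close> lie in
  \<open>X + Y\<close> and can share only \<open>Min X + Max Y\<close>.\<close>

lemma card_plus_ge:
  fixes X Y :: "int set"
  assumes "finite X" "finite Y" "X \<noteq> {}" "Y \<noteq> {}"
  shows "card X + card Y \<le> card (X + Y) + 1"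
proof -
  define U where "U = (\<lambda>y. Min X + y) ` Y"
  define V where "V = (\<lambda>x. x + Max Y) ` X"
  have "U \<union> V \<subseteq> X + Y"
    using Min_in[OF assms(1,3)] Max_in[OF assms(2,4)]
    by (auto simp: U_def V_def intro!: set_plus_intro)
  then have "card (U \<union> V) \<le> card (X + Y)"
    using assms by (intro card_mono finite_set_plus)
  moreover have "U \<inter> V \<subseteq> {Min X + Max Y}"
  proof
    fix z assume "z \<in> U \<inter> V"
    then obtain x y where xy: "x \<in> X" "y \<in> Y" "z = Min X + y" "z = x + Max Y"
      by (auto simp: U_def V_def)
    then have "Min X \<le> x" "y \<le> Max Y"
      using assms by auto
    then show "z \<in> {Min X + Max Y}"
      using xy by simp
  qed
  then have "card (U \<inter> V) \<le> 1"
    using card_mono[of "{Min X + Max Y}" "U \<inter> V"] by simp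
  moreover have "card U = card Y" "card V = card X"
    by (auto simp: U_def V_def card_image)
  moreover have "card U + card V = card (U \<union> V) + card (U \<inter> V)"
    using assms by (intro card_Un_Int) (auto simp: U_def V_def)
  ultimately show ?thesis
    by linarith
qed

lemma mem_multiples_plus:
  fixes X :: "int set"
  shows "x \<in> {x. d dvd x} + X \<longleftrightarrow> (\<exists>y\<in>X. d dvd x - y)"
proof
  assume "x \<in> {x. d dvd x} + X"
  then show "\<exists>y\<in>X. d dvd x - y"
    by (force elim!: set_plus_elim)
next
  assume "\<exists>y\<in>X. d dvd x - y"
  then obtain y where "y \<in> X" "d dvd x - y"
    by blast
  then have "(x - y) + y \<in> {x. d dvd x} + X"
    by (intro set_plus_intro) auto
  then show "x \<in> {x. d dvd x} + X"
    by simp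
qed

lemma periodic_multiples: "periodic d {x. d dvd x}"
  by (auto simp: periodic_def)

text \<open>Each residue class met by \<open>C\<close> contains an element of \<open>C - B\<close>:
  namely \<open>b + l\<close> for the largest \<open>b\<close> of \<open>B\<close> in the class, or
  any element of \<open>C\<close> if \<open>B\<close> misses the class. \<open>R\<close> selects
  which classes are counted.\<close>

lemma card_ge_residues:
  fixes B C :: "int set"
  assumes l: "l > 0" and "finite C" "B \<subseteq> C" "\<And>b. b \<in> B \<Longrightarrow> b + l \<in> C" "periodic l R"
  shows "card (B \<inter> R) + dens l (({x. l dvd x} + C) \<inter> R) \<le> card (C \<inter> R)"
proof -
  have fin: "finite B"
    using assms(2,3) finite_subset by blast
  have "\<exists>z. z \<in> (C - B) \<inter> R \<and> l dvd z - c" if c: "c \<in> ({x. l dvd x} + C) \<inter> R" for c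
  proof (cases "\<exists>b\<in>B. l dvd b - c")
    case True
    define b where "b = Max {b\<in>B. l dvd b - c}"
    have "b \<in> {b\<in>B. l dvd b - c}"
      unfolding b_def using fin True by (intro Max_in) auto
    then have b: "b \<in> B" "l dvd b - c"
      by auto
    have dvd: "l dvd (b + l) - c"
      using dvd_add[OF b(2) dvd_refl[of l]] by (simp add: algebra_simps)
    have "b + l \<notin> B"
    proof
      assume "b + l \<in> B"
      then have "b + l \<le> b"
        unfolding b_def using fin dvd by (intro Max_ge) (auto simp: b_def)
      then show False
        using l by simp
    qed
    moreover have "b + l \<in> R"
      using periodic_cong[OF assms(5) dvd] c by blast
    ultimately show ?thesis
      using assms(4)[OF b(1)] dvd by blast
  next
    case False
    obtain z where z: "z \<in> C" "l dvd c - z"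
      using c by (auto simp: mem_multiples_plus)
    then have dvd: "l dvd z - c"
      by (simp add: dvd_diff_commute)
    moreover have "z \<in> R"
      using periodic_cong[OF assms(5) dvd] c by blast
    ultimately show ?thesis
      using z False by blast
  qed
  then obtain g where g: "\<And>c. c \<in> ({x. l dvd x} + C) \<inter> R \<Longrightarrow> g c \<in> (C - B) \<inter> R \<and> l dvd g c - c"
    by metis
  have "card (({x. l dvd x} + C) \<inter> R \<inter> {0..<l}) \<le> card ((C - B) \<inter> R)"
  proof (rule card_inj_on_le[where f = g])
    show "inj_on g (({x. l dvd x} + C) \<inter> R \<inter> {0..<l})"
    proof (rule inj_onI)
      fix x y assume xy: "x \<in> ({x. l dvd x} + C) \<inter> R \<inter> {0..<l}"
        "y \<in> ({x. l dvd x} + C) \<inter> R \<inter> {0..<l}" "g x = g y"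
      then have "l dvd g x - x" "l dvd g x - y"
        using g by (metis IntD1)+
      then have "x mod l = y mod l"
        by (metis mod_eq_dvd_iff)
      then show "x = y"
        using xy by simp
    qed
  qed (use g assms(2) in auto)
  moreover have "card (B \<inter> R) + card ((C - B) \<inter> R) = card (C \<inter> R)"
    using assms(2,3) fin by (subst card_Un_disjoint[symmetric]) (auto intro!: arg_cong[of _ _ card])
  ultimately show ?thesis
    by (simp add: dens_def)
qed

text \<open>By \<open>card_plus_ge\<close>, each further summand adds at least \<open>q - 1\<close>
  elements inside the residue class.\<close>

lemma card_mfold_sumset_class:
  fixes A :: "int set"
  assumes "finite A" "q \<ge> 1"
    and "set xs \<subseteq> A" "\<And>a. a \<in> set xs \<Longrightarrow> int (card (A \<inter> {x. d dvd x - a})) \<ge> q"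
  shows "int (length xs) * (q - 1) + 1
    \<le> int (card (mfold_sumset (length xs) A \<inter> {x. d dvd x - sum_list xs}))"
  using assms(3,4)
proof (induction xs)
  case Nil
  have "{0} \<inter> {x. d dvd x} = {0}"
    by auto
  then show ?case
    by simp
next
  case (Cons a xs)
  define X where "X = mfold_sumset (length xs) A \<inter> {x. d dvd x - sum_list xs}"
  define Y where "Y = A \<inter> {x. d dvd x - a}"
  have fin: "finite X" "finite Y"
    using assms(1) by (auto simp: X_def Y_def finite_mfold_sumset)
  have "sum_list xs \<in> X" "a \<in> Y"
    using Cons.prems by (auto simp: X_def Y_def intro: mfold_sumsetI)
  then have "card X + card Y \<le> card (X + Y) + 1"
    using fin by (intro card_plus_ge) auto
  moreover have "X + Y \<subseteq> mfold_sumset (Suc (length xs)) A \<inter> {x. d dvd x - (a + sum_list xs)}"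
  proof
    fix z assume "z \<in> X + Y"
    then obtain x y where xy: "x \<in> X" "y \<in> Y" "z = x + y"
      by (auto elim: set_plus_elim)
    have "d dvd (x - sum_list xs) + (y - a)"
      using xy by (intro dvd_add) (auto simp: X_def Y_def)
    moreover have "(x - sum_list xs) + (y - a) = z - (a + sum_list xs)"
      using xy(3) by simp
    moreover have "z \<in> mfold_sumset (Suc (length xs)) A"
      unfolding mfold_sumset_Suc xy(3) using xy by (intro set_plus_intro) (auto simp: X_def Y_def)
    ultimately show "z \<in> mfold_sumset (Suc (length xs)) A \<inter> {x. d dvd x - (a + sum_list xs)}"
      by simp
  qed
  then have "card (X + Y) \<le> card (mfold_sumset (Suc (length xs)) A \<inter> {x. d dvd x - (a + sum_list xs)})"
    using assms(1) by (intro card_mono) (auto simp: finite_mfold_sumset)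
  moreover have "int (length xs) * (q - 1) + 1 \<le> int (card X)"
    unfolding X_def using Cons by auto
  moreover have "q \<le> int (card Y)"
    unfolding Y_def using Cons.prems by auto
  ultimately show ?case
    by (simp add: algebra_simps)
qed

text \<open>Lev's inequality. Modulo \<open>l\<close> it can fail only because of the isoperimetric subgroup \<open>d\<int>\<close>; a
  residue class modulo \<open>d\<close> that is new in the \<open>Suc h\<close>-fold sumset makes up for the deficit, as there
  the integer sumsets grow. A summand is thin if \<open>A\<close> meets at most half of its class modulo \<open>d\<close>:
  only classes represented solely by thin summands can be incomplete.\<close>

theorem sumset_growth:
  fixes A :: "int set"
  assumes A: "finite A" "A \<subseteq> {0..l}" "0 \<in> A" "l \<in> A" and l: "l > 0" and gcd: "Gcd A = 1"
  shows "int (card (mfold_sumset h A)) + min l (int (Suc h) * (int (card A) - 2) + 1)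
    \<le> int (card (mfold_sumset (Suc h) A))"
proof -
  define n where "n = int (card A)"
  define P where "P i = {x. l dvd x} + mfold_sumset i A" for i
  define K where "K = {x. l dvd x} + A"
  have sub: "mfold_sumset h A \<subseteq> mfold_sumset (Suc h) A"
    using A(3) by (intro mfold_sumset_mono) auto
  have sub_l: "b + l \<in> mfold_sumset (Suc h) A" if "b \<in> mfold_sumset h A" for b
    unfolding mfold_sumset_Suc using that A(4) by (intro set_plus_intro)
  note gain = card_ge_residues[OF l finite_mfold_sumset[OF A(1)] sub sub_l]
  consider "P (Suc h) = UNIV" | "h = 0" | "P (Suc h) \<noteq> UNIV" "h \<ge> 1"
    by fastforce
  then show ?thesis
  proof cases
    case 1
    have "periodic l UNIV"
      by (simp add: periodic_def)
    from gain[OF _ this] have "card (mfold_sumset h A) + dens l (P (Suc h)) \<le> card (mfold_sumset (Suc h) A)"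
      by (simp add: P_def)
    then show ?thesis
      using dens_UNIV[OF l] 1 by simp
  next
    case 2
    then show ?thesis
      by simp
  next
    case 3
    have K_sub: "K \<subseteq> P i" if "i \<ge> 1" for i
      unfolding P_def K_def using mfold_sumset_mono[OF A(3) that] by (intro set_plus_mono2) auto
    then have K_ne: "K \<noteq> UNIV"
      using 3 by (metis le_SucI order_refl top.extremum_uniqueI)
    obtain d where d: "d > 0" "d dvd l" "{x. d dvd x} + A \<noteq> UNIV" and
      iso: "\<And>T. periodic l T \<Longrightarrow> T \<noteq> {} \<Longrightarrow> T + A \<noteq> UNIV \<Longrightarrow>
       dens l T + dens l ({x. d dvd x} + A) \<le> dens l (T + A) + dens l {x. d dvd x}"
    proof (rule isoperimetric_subgroup[OF l _ periodic_multiples[of l]])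
      show "A \<noteq> {}" "{x. l dvd x} \<noteq> {}" "{x. l dvd x} + A \<noteq> UNIV"
        using A(3) K_ne by (auto simp: K_def)
    qed blast
    define Q where "Q i = {x. d dvd x} + mfold_sumset i A" for i
    define W where "W = {x. d dvd x} + A"
    define C where "C a = {x. d dvd x - a}" for a
    \<comment> \<open>In residues modulo \<open>l\<close>: \<open>s\<close> is the size of a class
      modulo \<open>d\<close>, \<open>e a\<close> the filled part of the class of \<open>a\<close>,
      \<rho> the number of holes of \<open>A\<close> in the classes it meets, and \<kappa> the
      growth of \<open>Q\<close> per step.\<close>
    define s where "s = int (dens l {x. d dvd x})"
    define e where "e a = int (dens l (C a \<inter> K))" for a
    define \<rho> where "\<rho> = int (dens l W) - (n - 1)"
    define \<kappa> where "\<kappa> = int (dens l W) - s"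
    have perD: "periodic l {x. d dvd x}"
      using periodic_dvd[OF periodic_multiples d(2)] .
    have perQ: "periodic l (Q i)" and perQd: "periodic d (Q i)" for i
      unfolding Q_def by (intro periodic_plus periodic_multiples perD)+
    have perK: "periodic l K"
      unfolding K_def by (intro periodic_plus periodic_multiples)
    have perW: "periodic l W"
      unfolding W_def by (intro periodic_plus perD)
    have perC: "periodic l (C a)" for a
      using periodic_shift[OF perD, of a] by (simp add: C_def)
    have C_dens: "int (dens l (C a)) = s" for a
      using dens_shift[OF l perD, of a] by (simp add: C_def s_def)
    have C_cong: "C a = C b" if "d dvd a - b" for a b
    proof -
      have "d dvd x - a \<longleftrightarrow> d dvd x - b" for x
        using dvd_add_left_iff[OF that, of "x - a"] by simp
      then show ?thesis
        by (simp add: C_def)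
    qed
    have Q_iff: "x \<in> Q i \<longleftrightarrow> (\<exists>xs. set xs \<subseteq> A \<and> length xs = i \<and> d dvd x - sum_list xs)" for x i
      by (metis (no_types, lifting) Q_def mem_multiples_plus mfold_sumset_iff_list)
    have P_sub_Q: "P i \<subseteq> Q i" for i
    proof
      fix x assume "x \<in> P i"
      then obtain y where "y \<in> mfold_sumset i A" "l dvd x - y"
        unfolding P_def mem_multiples_plus by blast
      then show "x \<in> Q i"
        unfolding Q_def mem_multiples_plus using dvd_trans[OF d(2)] by blast
    qed
    have Q_Suc: "Q (Suc i) = Q i + A" for i
      by (simp add: Q_def mfold_sumset_Suc add.assoc)
    have Q_mono: "Q i \<subseteq> Q (Suc i)" for i
      unfolding Q_def using mfold_sumset_mono[OF A(3), of i "Suc i"] by (intro set_plus_mono2) auto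
    have Q0: "Q 0 = {x. d dvd x}"
      by (auto simp: Q_def mem_multiples_plus)
    have Q_1: "Q (Suc 0) = W" and P_1: "P (Suc 0) = K"
      by (simp_all add: Q_def W_def P_def K_def)
    have zero_Q: "0 \<in> Q i" for i
      using A(3) by (auto simp: Q_iff sum_list_replicate intro!: exI[of _ "replicate i 0"])

    have "K \<inter> {0..<l} = A - {l}"
    proof (intro set_eqI iffI)
      fix x assume x: "x \<in> K \<inter> {0..<l}"
      then obtain a where a: "a \<in> A" "l dvd x - a"
        by (auto simp: K_def mem_multiples_plus)
      then have "x = a mod l"
        using x by (metis IntD2 atLeastLessThan_iff mod_eq_dvd_iff mod_pos_pos_trivial)
      moreover have "0 \<le> a" "a \<le> l"
        using a(1) A(2) by auto
      ultimately show "x \<in> A - {l}"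
        using a(1) A(3) x by (cases "a = l") auto
    next
      fix x assume "x \<in> A - {l}"
      then show "x \<in> K \<inter> {0..<l}"
        using A(2) by (force simp: K_def mem_multiples_plus)
    qed
    note K_Int = this
    then have K_int: "K \<inter> {0..<l} \<subseteq> A"
      by blast
    have "card A > 0"
      using A(1,3) by (auto simp: card_gt_0_iff)
    then have K_dens: "int (dens l K) = n - 1"
      unfolding dens_def K_Int n_def using A(4) by (simp add: of_nat_diff)
    have L_dens: "dens l {x. l dvd x} = 1"
    proof -
      have "{x. l dvd x} \<inter> {0..<l} \<subseteq> {0}"
      proof
        fix x assume "x \<in> {x. l dvd x} \<inter> {0..<l}"
        then have "l dvd x" "0 \<le> x" "x < l"
          by auto
        then have "x = 0"
          by (metis order_le_less zdvd_not_zless)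
        then show "x \<in> {0}"
          by simp
      qed
      moreover have "{0} \<subseteq> {x. l dvd x} \<inter> {0..<l}"
        using l by simp
      ultimately have "{x. l dvd x} \<inter> {0..<l} = {0}"
        by (rule subset_antisym)
      then show ?thesis
        by (simp add: dens_def)
    qed
    \<comment> \<open>Testing the isoperimetric inequality on the multiples of \<open>l\<close>
      shows that the holes do not even fill one class.\<close>
    have "dens l {x. l dvd x} + dens l W \<le> dens l K + dens l {x. d dvd x}"
      unfolding K_def W_def using K_ne by (intro iso periodic_multiples) (auto simp: K_def)
    then have "\<kappa> \<le> n - 2"
      using K_dens L_dens by (simp add: \<kappa>_def s_def)
    then have \<rho>_le: "\<rho> \<le> s - 1"
      by (simp add: \<kappa>_def \<rho>_def)
    have miss_dens: "int (dens l (W - K)) = \<rho>"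
      using dens_Diff[of l "W" "K"] P_sub_Q[of "Suc 0"] K_dens by (simp add: \<rho>_def Int_absorb1 Q_1 P_1)
    have C_sub: "C a \<subseteq> W" if "a \<in> A" for a
      using that by (auto simp: C_def W_def mem_multiples_plus)
    have e_eq: "e a = s - int (dens l (C a - K))" for a
      using dens_Diff[of l "C a" "K"] C_dens[of a] by (simp add: e_def)
    have e_ge: "e a \<ge> s - \<rho>" if "a \<in> A" for a
      using dens_mono[OF Diff_mono[OF C_sub[OF that] order_refl], of l K] miss_dens by (simp add: e_eq)
    have e_ge2: "e a + e b \<ge> 2 * s - \<rho>" if "a \<in> A" "b \<in> A" "\<not> d dvd a - b" for a b
    proof -
      have "C a \<inter> C b = {}"
      proof (rule ccontr)
        assume "C a \<inter> C b \<noteq> {}"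
        then obtain x where "d dvd x - a" "d dvd x - b"
          by (auto simp: C_def)
        then have "d dvd (x - b) - (x - a)"
          by (metis dvd_diff)
        then show False
          using that(3) by simp
      qed
      then have "(C a - K) \<inter> (C b - K) = {}"
        by blast
      then have "dens l (C a - K) + dens l (C b - K) = dens l ((C a - K) \<union> (C b - K))"
        using dens_Un_Int[of l "C a - K" "C b - K"] by simp
      also have "\<dots> \<le> dens l (W - K)"
        using C_sub that by (intro dens_mono) blast
      finally show ?thesis
        using miss_dens by (simp add: e_eq)
    qed
    have e_card: "e a \<le> int (card (A \<inter> C a))" for a
      unfolding e_def dens_def using A(1) K_int by (intro of_nat_mono card_mono) auto

    \<comment> \<open>Pigeonhole: for a second summand \<open>b\<close>, the filled part of the
      class of \<open>a\<close> and the reflected filled part of the class of \<open>b\<close> have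
      together more than \<open>s\<close> elements of one class, so they meet. Hence
      \<open>a + b\<close> can be adjusted to any residue of its class.\<close>
    have full: "C (sum_list xs) \<subseteq> P (Suc h)"
      if xs: "set xs \<subseteq> A" "length xs = Suc h" and a: "a \<in> set xs" "2 * e a > s" for xs a
    proof
      fix y assume y: "y \<in> C (sum_list xs)"
      obtain b zs where zs: "remove1 a xs = b # zs"
        using xs(2) a(1) \<open>h \<ge> 1\<close> by (cases "remove1 a xs") (auto simp: length_remove1 dest: arg_cong[of _ _ length])
      have mset: "mset xs = mset (a # b # zs)"
        using a(1) by (simp flip: zs)
      have sum: "sum_list xs = a + b + sum_list zs"
        using mset by (metis add.assoc sum_list.Cons sum_mset_sum_list)
      have len: "length zs + 2 = Suc h"
        using arg_cong[OF mset, of size] xs(2) by simp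
      have set: "set xs = insert a (insert b (set zs))"
        using mset by (metis set_mset_mset list.simps(15))
      have ab: "a \<in> A" "b \<in> A" "set zs \<subseteq> A"
        using xs(1) set by auto
      have gt: "e a + e b > s"
      proof (cases "d dvd a - b")
        case True
        then show ?thesis
          using a(2) C_cong[OF True] by (simp add: e_def)
      next
        case False
        then show ?thesis
          using e_ge2[OF ab(1,2) False] \<rho>_le by linarith
      qed
      define X where "X = C a \<inter> K"
      define Y where "Y = {u. (y - sum_list zs) - u \<in> C b \<inter> K}"
      have "int (dens l Y) = e b"
        using dens_reflection[OF l periodic_Int[OF perC perK]] by (simp add: Y_def e_def)
      moreover have "X \<union> Y \<subseteq> C a"
      proof
        fix u assume "u \<in> X \<union> Y"
        then show "u \<in> C a"
        proof
          assume "u \<in> Y"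
          then have "d dvd (y - sum_list zs - u) - b"
            by (simp add: Y_def C_def)
          moreover have "d dvd y - (a + b + sum_list zs)"
            using y by (simp add: C_def sum)
          ultimately have "d dvd (y - (a + b + sum_list zs)) - ((y - sum_list zs - u) - b)"
            by (metis dvd_diff)
          then show ?thesis
            by (simp add: C_def)
        qed (simp add: X_def)
      qed
      then have "int (dens l (X \<union> Y)) \<le> s"
        using dens_mono C_dens by (metis of_nat_le_iff)
      ultimately have "int (dens l (X \<inter> Y)) > 0"
        using dens_Un_Int[of l X Y] gt by (simp add: e_def X_def)
      then have "X \<inter> Y \<noteq> {}"
        by auto
      then obtain u where u: "u \<in> K" "y - sum_list zs - u \<in> K"
        by (auto simp: X_def Y_def)
      then obtain a' b' where ab': "a' \<in> A" "l dvd u - a'" "b' \<in> A" "l dvd (y - sum_list zs - u) - b'"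
        unfolding K_def mem_multiples_plus by blast
      have "l dvd (u - a') + ((y - sum_list zs - u) - b')"
        using ab' by (intro dvd_add)
      then have "l dvd y - sum_list (a' # b' # zs)"
        by (simp add: algebra_simps)
      moreover have "sum_list (a' # b' # zs) \<in> mfold_sumset (Suc h) A"
        using ab' ab(3) len by (intro mfold_sumsetI[of "a' # b' # zs"]) auto
      ultimately show "y \<in> P (Suc h)"
        unfolding P_def mem_multiples_plus by blast
    qed
    have bad_thin: "2 * e a \<le> s"
      if "x \<notin> P (Suc h)" "set xs \<subseteq> A" "length xs = Suc h" "d dvd x - sum_list xs" "a \<in> set xs"
      for x xs a
      using full[OF that(2,3,5)] that(1,4) by (force simp: C_def)
    \<comment> \<open>Two different thin classes would have at least \<open>s\<close> holes
      together, but there are fewer.\<close>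
    have thin_cong: "d dvd a - b" if "2 * e a \<le> s" "2 * e b \<le> s" "a \<in> A" "b \<in> A" for a b
      using e_ge2[OF that(3,4)] that(1,2) \<rho>_le by linarith
    have sum_cong: "d dvd sum_list xs - int (length xs) * b"
      if "\<And>a. a \<in> set xs \<Longrightarrow> d dvd a - b" for xs b
      using that
    proof (induction xs)
      case (Cons a xs)
      then have "d dvd (a - b) + (sum_list xs - int (length xs) * b)"
        by (intro dvd_add) auto
      then show ?case
        by (simp add: algebra_simps)
    qed simp

    have Q_dens: "int i * \<kappa> + s \<le> int (dens l (Q i))" if "Q i \<noteq> UNIV" for i
      using that
    proof (induction i)
      case 0
      then show ?case
        by (simp add: Q0 s_def)
    next
      case (Suc i)
      then have "Q i \<noteq> UNIV"
        using Q_mono[of i] by auto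
      moreover have "Q i \<noteq> {}"
        using zero_Q by blast
      then have "dens l (Q i) + dens l W \<le> dens l (Q (Suc i)) + dens l {x. d dvd x}"
        using iso[OF perQ, of i] Suc.prems by (simp add: Q_Suc W_def)
      ultimately show ?case
        using Suc.IH by (simp add: \<kappa>_def s_def algebra_simps)
    qed
    have \<kappa>_pos: "\<kappa> > 0"
    proof (rule ccontr)
      assume "\<not> \<kappa> > 0"
      then have "Q 0 = W"
        using Q_mono[of 0] by (intro dens_subset_eq[OF l perQ perW]) (auto simp: \<kappa>_def s_def Q0 Q_1)
      then have "Q 0 + A \<subseteq> Q 0"
        using Q_Suc[of 0] by (simp add: Q_1)
      then have "Q 0 = UNIV"
        using closed_under_generators[OF l perQ zero_Q] gcd by blast
      then show False
        using \<open>Q 0 = W\<close> d(3) by (simp add: W_def)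
    qed
    \<comment> \<open>If \<open>Q (Suc h)\<close> is everything, \<open>Q_dens\<close> does not
      apply to it. Instead a missed residue \<open>x\<close> has only thin summands, all congruent,
      so \<open>Q h\<close> and \<open>x - W\<close> share at most one class; this bounds their
      total size by \<open>l + s\<close>.\<close>
    have Qh: "Q h \<noteq> UNIV \<and> int (Suc h) * \<kappa> + s \<le> int (dens l (Q (Suc h)))"
    proof (cases "Q (Suc h) = UNIV")
      case False
      then show ?thesis
        using Q_mono[of h] Q_dens[OF False] by auto
    next
      case True
      obtain x where x: "x \<notin> P (Suc h)"
        using 3 by blast
      obtain xs where xs: "set xs \<subseteq> A" "length xs = Suc h" "d dvd x - sum_list xs"
        using True Q_iff by blast
      define a where "a = hd xs"
      have a: "a \<in> set xs"
        using xs(2) by (cases xs) (auto simp: a_def)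
      define T where "T = {u. x - u \<in> W}"
      have "Q h \<inter> T \<subseteq> C (x - a)"
      proof
        fix u assume "u \<in> Q h \<inter> T"
        then obtain ys b where ys: "set ys \<subseteq> A" "length ys = h" "d dvd u - sum_list ys"
          and b: "b \<in> A" "d dvd (x - u) - b"
          by (auto simp: T_def Q_iff[of _ h] W_def mem_multiples_plus)
        have "d dvd (u - sum_list ys) + ((x - u) - b)"
          using ys b by (intro dvd_add)
        then have "d dvd x - sum_list (b # ys)"
          by (simp add: algebra_simps)
        then have "2 * e b \<le> s"
          using ys b by (intro bad_thin[OF x, of "b # ys"]) auto
        then have "d dvd a - b"
          using bad_thin[OF x xs a] a b(1) xs(1) by (intro thin_cong) auto
        then have "d dvd (a - b) - ((x - u) - b)"
          using b(2) by (metis dvd_diff)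
        then show "u \<in> C (x - a)"
          by (simp add: C_def algebra_simps)
      qed
      then have "int (dens l (Q h \<inter> T)) \<le> s"
        using dens_mono C_dens by (metis of_nat_le_iff)
      moreover have "dens l T = dens l W"
        unfolding T_def by (rule dens_reflection[OF l perW])
      ultimately have *: "int (dens l (Q h)) + int (dens l W) \<le> l + s"
        using dens_Un_Int[of l "Q h" T] dens_le[OF l, of "Q h \<union> T"] by linarith
      have "Q h \<noteq> UNIV"
        using * \<kappa>_pos dens_UNIV[OF l] by (auto simp: \<kappa>_def)
      moreover have "int (Suc h) * \<kappa> + s \<le> l"
        using Q_dens[OF calculation] * by (simp add: \<kappa>_def algebra_simps)
      ultimately show ?thesis
        using True dens_UNIV[OF l] by simp
    qed
    have new: "\<exists>x. x \<in> Q (Suc h) \<and> x \<notin> Q h"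
    proof (rule ccontr)
      assume "\<not> ?thesis"
      then have "Q h + A \<subseteq> Q h"
        using Q_Suc[of h] by blast
      then show False
        using closed_under_generators[OF l perQ zero_Q] gcd Qh by blast
    qed

    \<comment> \<open>The class of \<open>x\<close> is new modulo \<open>d\<close> and will be
      counted in the integers. \<open>r\<close> is what an incomplete class elsewhere may cost; the
      summands of \<open>x\<close> must then be correspondingly denser.\<close>
    have "\<exists>x r. x \<in> Q (Suc h) \<and> x \<notin> Q h \<and> r \<ge> 0 \<and>
      int (dens l (P (Suc h) - C x)) \<ge> int (dens l (Q (Suc h))) - s - r \<and>
      (\<forall>xs. set xs \<subseteq> A \<longrightarrow> length xs = Suc h \<longrightarrow> d dvd x - sum_list xs \<longrightarrow>
         (\<forall>a\<in>set xs. e a \<ge> s - \<rho> + r))"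
    proof (cases "2 * e 0 \<le> s")
      case True
      \<comment> \<open>With \<open>0\<close> thin, all thin elements are multiples of
        \<open>d\<close>, so only the class of \<open>0\<close> can be incomplete. It has
        \<open>s - e 0\<close> holes, which serves as \<open>r\<close>.\<close>
      obtain x where x: "x \<in> Q (Suc h)" "x \<notin> Q h"
        using new by blast
      have C0: "C 0 \<subseteq> Q h"
        using A(3) by (auto simp: Q_iff C_def sum_list_replicate intro!: exI[of _ "replicate h 0"])
      have C0_x: "C 0 \<inter> C x = {}"
      proof (rule ccontr)
        assume "C 0 \<inter> C x \<noteq> {}"
        then obtain u where "u \<in> Q h" "d dvd u - x"
          using C0 by (auto simp: C_def)
        then show False
          using periodic_cong[OF perQd] x(2) by blast
      qed
      have in_P: "u \<in> P (Suc h)" if u: "u \<in> Q (Suc h)" "u \<notin> C 0" for u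
      proof (rule ccontr)
        assume nP: "u \<notin> P (Suc h)"
        obtain xs where xs: "set xs \<subseteq> A" "length xs = Suc h" "d dvd u - sum_list xs"
          using u(1) Q_iff by blast
        have "d dvd a - 0" if "a \<in> set xs" for a
          using bad_thin[OF nP xs that] True that xs(1) A(3) by (intro thin_cong) auto
        then have "d dvd sum_list xs"
          using sum_cong[of xs 0] by simp
        then have "d dvd (u - sum_list xs) + sum_list xs"
          using xs(3) by (intro dvd_add)
        then show False
          using u(2) by (simp add: C_def)
      qed
      have "(Q (Suc h) - C x - C 0) \<union> (C 0 \<inter> K) \<subseteq> P (Suc h) - C x"
        using in_P K_sub[of "Suc h"] C0_x by auto
      then have "dens l ((Q (Suc h) - C x - C 0) \<union> (C 0 \<inter> K)) \<le> dens l (P (Suc h) - C x)"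
        by (rule dens_mono)
      moreover have "(Q (Suc h) - C x - C 0) \<inter> (C 0 \<inter> K) = {}"
        by blast
      ultimately have "dens l (Q (Suc h) - C x - C 0) + dens l (C 0 \<inter> K) \<le> dens l (P (Suc h) - C x)"
        using dens_Un_Int[of l "Q (Suc h) - C x - C 0" "C 0 \<inter> K"] by simp
      moreover have "dens l (Q (Suc h)) \<le> dens l (Q (Suc h) - C x - C 0) + dens l (C x) + dens l (C 0)"
        using dens_Diff[of l "Q (Suc h)" "C x"] dens_Diff[of l "Q (Suc h) - C x" "C 0"]
          dens_mono[of "Q (Suc h) \<inter> C x" "C x" l] dens_mono[of "(Q (Suc h) - C x) \<inter> C 0" "C 0" l]
        by simp
      ultimately have "int (dens l (P (Suc h) - C x)) \<ge> int (dens l (Q (Suc h))) - s - (s - e 0)"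
        using C_dens[of x] C_dens[of 0] by (simp add: e_def)
      moreover have "s - e 0 \<ge> 0"
        by (simp add: e_eq)
      \<comment> \<open>A summand divisible by \<open>d\<close> could be dropped, putting
        \<open>x\<close> into \<open>Q h\<close>; so \<open>e_ge2\<close> applies to
        \<open>a\<close> and \<open>0\<close>.\<close>
      moreover have "e a \<ge> s - \<rho> + (s - e 0)"
        if xs: "set xs \<subseteq> A" "length xs = Suc h" "d dvd x - sum_list xs" and a: "a \<in> set xs" for xs a
      proof -
        have "\<not> d dvd a - 0"
        proof
          assume "d dvd a - 0"
          then have "d dvd a"
            by simp
          have "sum_list xs = a + sum_list (remove1 a xs)"
            using a by (rule sum_list_map_remove1[of a xs "\<lambda>x. x", simplified])
          then have "d dvd x - sum_list (remove1 a xs)"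
            using dvd_add[OF xs(3) \<open>d dvd a\<close>] by (simp add: algebra_simps)
          moreover have "set (remove1 a xs) \<subseteq> A" "length (remove1 a xs) = h"
            using xs a set_remove1_subset[of a xs] by (auto simp: length_remove1)
          ultimately show False
            using x(2) Q_iff by blast
        qed
        then show ?thesis
          using e_ge2[of a 0] a xs(1) A(3) by auto
      qed
      ultimately show ?thesis
        using x by blast
    next
      case False
      \<comment> \<open>Thin elements being congruent, at most one class is incomplete. It is new,
        as otherwise \<open>0\<close>, which is not thin, could be one of its summands;
        \<open>x\<close> is taken there if it exists, and in any new class otherwise.\<close>
      have "\<exists>x. x \<in> Q (Suc h) \<and> x \<notin> Q h \<and> Q (Suc h) - C x \<subseteq> P (Suc h)"
      proof (cases "Q (Suc h) \<subseteq> P (Suc h)")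
        case True
        then show ?thesis
          using new by blast
      next
        case nsub: False
        then obtain x where x: "x \<in> Q (Suc h)" "x \<notin> P (Suc h)"
          by blast
        have "x \<notin> Q h"
        proof
          assume "x \<in> Q h"
          then obtain ys where "set ys \<subseteq> A" "length ys = h" "d dvd x - sum_list ys"
            using Q_iff by blast
          then have "2 * e 0 \<le> s"
            using A(3) by (intro bad_thin[OF x(2), of "0 # ys"]) auto
          then show False
            using False by simp
        qed
        moreover have "u \<in> P (Suc h)" if u: "u \<in> Q (Suc h)" "u \<notin> C x" for u
        proof (rule ccontr)
          assume nP: "u \<notin> P (Suc h)"
          obtain xs where xs: "set xs \<subseteq> A" "length xs = Suc h" "d dvd x - sum_list xs"
            using x(1) Q_iff by blast
          obtain us where us: "set us \<subseteq> A" "length us = Suc h" "d dvd u - sum_list us"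
            using u(1) Q_iff by blast
          define b where "b = hd xs"
          have b: "b \<in> set xs"
            using xs(2) by (cases xs) (auto simp: b_def)
          have "d dvd a - b" if "a \<in> set xs" for a
            using bad_thin[OF x(2) xs] that b xs(1) by (intro thin_cong) auto
          then have 1: "d dvd sum_list xs - int (Suc h) * b"
            using sum_cong[of xs b] unfolding xs(2) by blast
          have "d dvd a - b" if "a \<in> set us" for a
            using bad_thin[OF x(2) xs b] bad_thin[OF nP us] that b xs(1) us(1) by (intro thin_cong) auto
          then have 2: "d dvd sum_list us - int (Suc h) * b"
            using sum_cong[of us b] unfolding us(2) by blast
          have "d dvd ((u - sum_list us) + (sum_list us - int (Suc h) * b))
              - ((x - sum_list xs) + (sum_list xs - int (Suc h) * b))"
            by (rule dvd_diff[OF dvd_add[OF us(3) 2] dvd_add[OF xs(3) 1]])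
          then show False
            using u(2) by (simp add: C_def)
        qed
        ultimately show ?thesis
          using x(1) by blast
      qed
      then obtain x where x: "x \<in> Q (Suc h)" "x \<notin> Q h" "Q (Suc h) - C x \<subseteq> P (Suc h)"
        by blast
      then have "Q (Suc h) - C x \<subseteq> P (Suc h) - C x"
        by blast
      then have "int (dens l (P (Suc h) - C x)) \<ge> int (dens l (Q (Suc h))) - s - 0"
        using dens_mono[of "Q (Suc h) - C x" "P (Suc h) - C x" l] dens_Diff[of l "Q (Suc h)" "C x"]
          dens_mono[of "Q (Suc h) \<inter> C x" "C x" l] C_dens[of x] by simp
      then show ?thesis
        using x e_ge by (intro exI[of _ x] exI[of _ 0]) auto
    qed
    then obtain x r where x: "x \<in> Q (Suc h)" "x \<notin> Q h" and r: "r \<ge> 0"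
      and dens_x: "int (dens l (P (Suc h) - C x)) \<ge> int (dens l (Q (Suc h))) - s - r"
      and e_x: "\<And>xs a. set xs \<subseteq> A \<Longrightarrow> length xs = Suc h \<Longrightarrow> d dvd x - sum_list xs \<Longrightarrow>
         a \<in> set xs \<Longrightarrow> e a \<ge> s - \<rho> + r"
      by blast
    obtain xs where xs: "set xs \<subseteq> A" "length xs = Suc h" "d dvd x - sum_list xs"
      using x(1) Q_iff by blast
    have "int (length xs) * ((s - \<rho> + r) - 1) + 1
      \<le> int (card (mfold_sumset (length xs) A \<inter> {u. d dvd u - sum_list xs}))"
    proof (rule card_mfold_sumset_class[OF A(1) _ xs(1)])
      show "1 \<le> s - \<rho> + r"
        using \<rho>_le r by simp
      show "s - \<rho> + r \<le> int (card (A \<inter> {x. d dvd x - a}))" if "a \<in> set xs" for a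
        using e_x[OF xs that] e_card[of a] by (simp add: C_def)
    qed
    moreover have "{u. d dvd u - sum_list xs} = C x"
      using C_cong[OF xs(3)] by (simp add: C_def)
    ultimately have in_class: "int (Suc h) * (s - \<rho> + r - 1) + 1 \<le> int (card (mfold_sumset (Suc h) A \<inter> C x))"
      by (simp add: xs(2))
    \<comment> \<open>The old sumset misses the new class, so the gain outside \<open>C x\<close>
      and the full count inside it add up.\<close>
    have "mfold_sumset h A \<inter> - C x = mfold_sumset h A"
    proof -
      have "u \<notin> C x" if "u \<in> mfold_sumset h A" for u
      proof
        assume "u \<in> C x"
        then have "d dvd x - u"
          by (simp add: C_def dvd_diff_commute)
        then show False
          using that x(2) by (auto simp: Q_def mem_multiples_plus)
      qed
      then show ?thesis
        by blast
    qed
    then have "card (mfold_sumset h A) + dens l (P (Suc h) - C x) \<le> card (mfold_sumset (Suc h) A \<inter> - C x)"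
      using gain[OF _ periodic_Compl[OF perC], of x] by (simp add: P_def Diff_eq)
    moreover have "card (mfold_sumset (Suc h) A)
      = card (mfold_sumset (Suc h) A \<inter> - C x) + card (mfold_sumset (Suc h) A \<inter> C x)"
      using finite_mfold_sumset[OF A(1), of "Suc h"]
      by (subst card_Un_disjoint[symmetric]) (auto intro!: arg_cong[of _ _ card])
    \<comment> \<open>The holes cancel: \<open>\<kappa> + s - \<rho> - 1 = n - 2\<close>. The loss
      \<open>r\<close> occurs once but is regained for each of the \<open>Suc h\<close>
      summands.\<close>
    moreover have "int (Suc h) * \<kappa> + int (Suc h) * (s - \<rho> + r - 1) = int (Suc h) * (n - 2) + int (Suc h) * r"
      by (simp add: \<kappa>_def \<rho>_def algebra_simps)
    moreover have "r \<le> int (Suc h) * r"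
      using r mult_right_mono[of 1 "int (Suc h)" r] by simp
    ultimately have "int (card (mfold_sumset h A)) + (int (Suc h) * (n - 2) + 1)
        \<le> int (card (mfold_sumset (Suc h) A))"
      using in_class dens_x Qh by linarith
    then show ?thesis
      by (simp add: n_def)
  qed
qed

section \<open>Exceptional sets\<close>

text \<open>By \<open>closed_under_generators\<close> the semigroup meets every class modulo
  \<open>l\<close>. Adding copies of \<open>l\<close> to a chosen representative reaches everything
  above it in its class.\<close>

lemma finite_exceptional_set:
  fixes A :: "int set"
  assumes A: "finite A" "l \<in> A" and l: "l > 0" and gcd: "Gcd A = 1"
  shows "finite (exceptional_set A)"
proof -
  define S where "S = (\<Union>w. mfold_sumset w A)"
  have "{x. l dvd x} + S = UNIV"
  proof (rule closed_under_generators[OF l periodic_plus[OF periodic_multiples] _ _ gcd])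
    have "(0::int) \<in> S"
      by (auto simp: S_def intro!: exI[of _ 0])
    then show "0 \<in> {x. l dvd x} + S"
      by (auto simp: mem_multiples_plus)
    have "S + A \<subseteq> S"
    proof
      fix x assume "x \<in> S + A"
      then obtain w where "x \<in> mfold_sumset (Suc w) A"
        by (auto simp: S_def mfold_sumset_Suc elim!: set_plus_elim)
      then show "x \<in> S"
        unfolding S_def by blast
    qed
    then show "{x. l dvd x} + S + A \<subseteq> {x. l dvd x} + S"
      unfolding add.assoc by (intro set_plus_mono2) auto
  qed
  then have "\<forall>c. \<exists>y\<in>S. l dvd c - y"
    using mem_multiples_plus[of _ l S] by blast
  then obtain g where g: "\<And>c. g c \<in> S" "\<And>c. l dvd c - g c"
    by metis
  define b where "b = Max (g ` {0..<l})"
  have "exceptional_set A \<subseteq> {0..b}"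
  proof
    fix x assume x: "x \<in> exceptional_set A"
    define y where "y = g (x mod l)"
    have "x < y"
    proof (rule ccontr)
      assume "\<not> x < y"
      have "l dvd (x - x mod l) + (x mod l - y)"
        unfolding y_def by (intro dvd_add g dvd_minus_mod)
      then obtain k where k: "x = y + l * k"
        by (metis add_diff_cancel_left' add_diff_eq diff_add_cancel dvdE add.commute)
      then have "k \<ge> 0"
        using \<open>\<not> x < y\<close> l by (simp add: zero_le_mult_iff not_less)
      obtain ys where ys: "set ys \<subseteq> A" "sum_list ys = y"
        using g(1)[of "x mod l"] by (auto simp: S_def y_def mfold_sumset_iff_list)
      have "x \<in> mfold_sumset (length ys + nat k) A"
        using ys A(2) k \<open>k \<ge> 0\<close> by (intro mfold_sumsetI[of "ys @ replicate (nat k) l"])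
          (auto simp: sum_list_replicate set_replicate_conv_if)
      then show False
        using x A(1) by (auto simp: mem_exceptional_set_iff)
    qed
    also have "y \<le> b"
      unfolding b_def y_def using l by (intro Max_ge) auto
    finally show "x \<in> {0..b}"
      using x by (simp add: exceptional_set_def)
  qed
  then show ?thesis
    by (rule finite_subset) simp
qed

lemma exc_max_ge: "finite E \<Longrightarrow> x \<in> E \<Longrightarrow> x \<le> exc_max E"
  by (auto simp: exc_max_def)

lemma exc_max_lower:
  assumes "finite E" "\<And>x. x \<in> E \<Longrightarrow> x > 0"
  shows "exc_max E \<ge> - 1"
  using assms Max_in[of E] by (fastforce simp: exc_max_def)

text \<open>If \<open>x\<close> and \<open>F - x\<close> were both in the semigroup, so would be
  \<open>F\<close>. The value \<open>- 1\<close> makes the inequality an equality for an empty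
  set.\<close>

lemma exc_max_le_card:
  assumes "finite A" and fin: "finite (exceptional_set A)"
  shows "exc_max (exceptional_set A) + 1 \<le> 2 * int (card (exceptional_set A))"
proof (cases "exceptional_set A = {}")
  case False
  define E where "E = exceptional_set A"
  define F where "F = Max E"
  have F: "F \<in> E"
    unfolding F_def using fin False by (simp add: E_def)
  have "{0..F} \<subseteq> E \<union> (\<lambda>x. F - x) ` E"
  proof (rule ccontr)
    assume "\<not> ?thesis"
    then obtain x where x: "0 \<le> x" "x \<le> F" "x \<notin> E" "F - x \<notin> E"
      by (force simp: image_iff)
    \<comment> \<open>The end points are excluded because \<open>F\<close> itself is
      exceptional.\<close>
    then have "0 < x" "0 < F - x"
      using F by (auto simp: order_le_less)
    then obtain w w' where "x \<in> mfold_sumset w A" "F - x \<in> mfold_sumset w' A"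
      using x assms(1) by (auto simp: E_def mem_exceptional_set_iff)
    then have "x + (F - x) \<in> mfold_sumset (w + w') A"
      unfolding mfold_sumset_add by (rule set_plus_intro)
    then show False
      using F assms(1) by (simp add: E_def mem_exceptional_set_iff)
  qed
  then have "card {0..F} \<le> card (E \<union> (\<lambda>x. F - x) ` E)"
    using fin by (intro card_mono) (auto simp: E_def)
  also have "\<dots> \<le> card E + card E"
    using card_Un_le[of E "(\<lambda>x. F - x) ` E"] card_image_le[of E "\<lambda>x. F - x"] fin
    by (simp add: E_def)
  finally show ?thesis
    using False by (simp add: exc_max_def E_def F_def)
qed (simp add: exc_max_def)

lemma reflect_properties:
  fixes A :: "int set"
  assumes "finite A" "A \<subseteq> {0..l}" "0 \<in> A" "l \<in> A" "Gcd A = 1"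
  shows "finite (reflect l A)" "reflect l A \<subseteq> {0..l}" "0 \<in> reflect l A" "l \<in> reflect l A"
    "Gcd (reflect l A) = 1"
proof -
  show "finite (reflect l A)" "reflect l A \<subseteq> {0..l}"
    using assms by (auto simp: reflect_def)
  show "0 \<in> reflect l A" and l: "l \<in> reflect l A"
    using assms by (simp_all add: mem_reflect_iff)
  have "Gcd (reflect l A) dvd a" if "a \<in> A" for a
  proof -
    have "Gcd (reflect l A) dvd l - (l - a)"
      using that l by (intro dvd_diff Gcd_dvd) (simp_all add: mem_reflect_iff)
    then show ?thesis
      by simp
  qed
  then have "Gcd (reflect l A) dvd Gcd A"
    by (rule Gcd_greatest)
  then have "is_unit (Gcd (reflect l A))"
    using assms(5) by simp
  then show "Gcd (reflect l A) = 1"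
    using Gcd_int_greater_eq_0[of "reflect l A"] by (simp add: zdvd1_eq)
qed

text \<open>The nontrivial inclusion is \<open>sumset_saturated\<close>; \<open>0\<close> is treated
  apart, since exceptional sets contain only positive integers.\<close>

lemma mfold_sumset_eq_complement:
  fixes A :: "int set"
  assumes A: "finite A" "A \<subseteq> {0..l}" "0 \<in> A" "l \<in> A" and l: "l > 0"
    and m: "int m \<ge> l - int (card A) + 2"
  shows "mfold_sumset m A
    = {0..int m * l} - (exceptional_set A \<union> reflect (int m * l) (exceptional_set (reflect l A)))"
proof (intro set_eqI iffI)
  have fin: "finite (reflect l A)"
    using A(1) by (simp add: reflect_def)
  {
    fix x assume x: "x \<in> mfold_sumset m A"
    then have "int m * l - x \<in> mfold_sumset m (reflect l A)"
      by (simp add: mfold_sumset_reflect)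
    then show "x \<in> {0..int m * l} - (exceptional_set A \<union> reflect (int m * l) (exceptional_set (reflect l A)))"
      using x mfold_sumset_bounds[OF A(2), of m] A(1) fin
      by (auto simp: mem_exceptional_set_iff mem_reflect_iff)
  next
    fix x assume x: "x \<in> {0..int m * l} - (exceptional_set A \<union> reflect (int m * l) (exceptional_set (reflect l A)))"
    have rep: "\<exists>w. y \<in> mfold_sumset w B" if "y \<ge> 0" "y \<notin> exceptional_set B" "finite B" for y B
    proof (cases "y = 0")
      case True
      then show ?thesis
        by (intro exI[of _ 0]) simp
    qed (use that in \<open>auto simp: mem_exceptional_set_iff\<close>)
    obtain w w' where "x \<in> mfold_sumset w A" "int m * l - x \<in> mfold_sumset w' (reflect l A)"
      using rep[of x A] rep[of "int m * l - x" "reflect l A"] x A(1) fin by (auto simp: mem_reflect_iff)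
    then show "x \<in> mfold_sumset m A"
      by (rule sumset_saturated[OF A l m])
  }
qed

text \<open>This is Castelnuovo's genus bound for the monomial curve with exponent set \<open>A\<close>, whose
  arithmetic genus is the left-hand side (halved).\<close>

lemma card_exceptional_sets_le:
  fixes A :: "int set"
  assumes A: "finite A" "A \<subseteq> {0..l}" "0 \<in> A" "l \<in> A" and l: "l > 0" and gcd: "Gcd A = 1"
    and n: "n = int (card A)" "n \<ge> 3"
    and k: "l - 1 = int k * (n - 2) + r" "0 \<le> r" "r \<le> n - 3"
  shows "2 * (int (card (exceptional_set A)) + int (card (exceptional_set (reflect l A))))
    \<le> 2 * int k * (l - 1) - int k * (int k + 1) * (n - 2)"
proof -
  \<comment> \<open>The number of integers in \<open>{0..int m * l}\<close> missed by the sumset;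
    for large \<open>m\<close> it is the total size of both exceptional sets.\<close>
  define \<delta> where "\<delta> m = int m * l + 1 - int (card (mfold_sumset m A))" for m
  have step: "\<delta> (Suc h) + min l (int (Suc h) * (n - 2) + 1) \<le> \<delta> h + l" for h
    using sumset_growth[OF A l gcd, of h] by (simp add: \<delta>_def n(1) algebra_simps)
  \<comment> \<open>\<open>k\<close> is where the minimum in \<open>sumset_growth\<close> switches:
    up to step \<open>k\<close> the linear term is the smaller one, afterwards it is
    \<open>l\<close> and \<delta> no longer increases.\<close>
  have up: "2 * \<delta> j \<le> 2 * int j * (l - 1) - int j * (int j + 1) * (n - 2)" if "j \<le> k" for j
    using that
  proof (induction j)
    case (Suc j)
    have "int (Suc j) * (n - 2) \<le> int k * (n - 2)"
      using Suc.prems n(2) by (intro mult_right_mono) auto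
    then have "int (Suc j) * (n - 2) + 1 \<le> l"
      using k by linarith
    then have "min l (int (Suc j) * (n - 2) + 1) = int (Suc j) * (n - 2) + 1"
      by (rule min_absorb2)
    then show ?case
      using step[of j] Suc by (simp add: algebra_simps)
  qed (simp add: \<delta>_def)
  have down: "\<delta> (k + i) \<le> \<delta> k" for i
  proof (induction i)
    case (Suc i)
    have "int (k + 1) * (n - 2) \<le> int (Suc (k + i)) * (n - 2)"
      using n(2) by (intro mult_right_mono) auto
    moreover have "int (k + 1) * (n - 2) = int k * (n - 2) + (n - 2)"
      by (simp add: algebra_simps)
    ultimately have "l \<le> int (Suc (k + i)) * (n - 2) + 1"
      using k by linarith
    then have "min l (int (Suc (k + i)) * (n - 2) + 1) = l"
      by (rule min_absorb1)
    then show ?case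
      using step[of "k + i"] Suc by simp
  qed simp
  define E where "E = exceptional_set A"
  define E' where "E' = exceptional_set (reflect l A)"
  note R = reflect_properties[OF A gcd]
  have fin: "finite E" "finite E'"
    unfolding E_def E'_def using finite_exceptional_set A(1,4) R l gcd by blast+
  have pos: "x > 0" if "x \<in> E \<or> x \<in> E'" for x
    using that by (auto simp: E_def E'_def exceptional_set_def)
  have max: "exc_max E \<ge> - 1" "exc_max E' \<ge> - 1"
    using fin pos by (auto intro!: exc_max_lower)
  \<comment> \<open>Large enough for saturation, and for the two exceptional parts to lie disjointly
    in \<open>{0..int m * l}\<close>.\<close>
  define i where "i = nat (l + exc_max E + exc_max E' + 3)"
  define m where "m = k + i"
  have m_ge: "int m \<ge> l + exc_max E + exc_max E' + 3"
    using max l by (simp add: m_def i_def)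
  have "int m * 1 \<le> int m * l"
    using l by (intro mult_left_mono) auto
  then have ml: "int m * l \<ge> l + exc_max E + exc_max E' + 3"
    using m_ge by simp
  have reflect_card: "card (reflect (int m * l) E') = card E'"
    by (simp add: reflect_def card_image inj_on_def)
  have disj: "E \<inter> reflect (int m * l) E' = {}"
  proof (rule ccontr)
    assume "E \<inter> reflect (int m * l) E' \<noteq> {}"
    then obtain x where "x \<in> E" "int m * l - x \<in> E'"
      by (auto simp: mem_reflect_iff)
    then have "x \<le> exc_max E" "int m * l - x \<le> exc_max E'"
      using fin by (auto intro: exc_max_ge)
    then show False
      using ml l by simp
  qed
  have sub: "E \<union> reflect (int m * l) E' \<subseteq> {0..int m * l}"
  proof
    fix x assume "x \<in> E \<union> reflect (int m * l) E'"
    then show "x \<in> {0..int m * l}"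
    proof
      assume "x \<in> E"
      then show ?thesis
        using exc_max_ge[OF fin(1), of x] pos[of x] ml max l by simp
    next
      assume "x \<in> reflect (int m * l) E'"
      then have "int m * l - x \<in> E'"
        by (simp add: mem_reflect_iff)
      then show ?thesis
        using exc_max_ge[OF fin(2), of "int m * l - x"] pos[of "int m * l - x"] ml max l by simp
    qed
  qed
  have fin_un: "finite (E \<union> reflect (int m * l) E')"
    using sub by (rule finite_subset) simp
  have "card (mfold_sumset m A) = card ({0..int m * l} - (E \<union> reflect (int m * l) E'))"
    using mfold_sumset_eq_complement[OF A l, of m] m_ge max n by (simp add: E_def E'_def)
  also have "\<dots> = card {0..int m * l} - card (E \<union> reflect (int m * l) E')"
    using sub fin_un by (rule card_Diff_subset[rotated])
  finally have "card (mfold_sumset m A) = card {0..int m * l} - (card E + card E')"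
    using fin fin_un disj reflect_card by (simp add: card_Un_disjoint)
  moreover have "card E + card E' \<le> card {0..int m * l}"
    using card_mono[OF _ sub] fin fin_un disj reflect_card by (simp add: card_Un_disjoint)
  ultimately have "int (card E) + int (card E') = \<delta> m"
    using ml max l by (simp add: \<delta>_def of_nat_diff)
  then show ?thesis
    using down[of i] up[of k] by (simp add: E_def E'_def m_def)
qed

section \<open>The structure of the sumsets and the length of the central interval\<close>

theorem theorem3:
  fixes A E E' :: "int set" and n l M :: int
  assumes "finite A" and "n = int (card A)" and "n \<ge> 3"
    and "Min A = 0" and "Gcd A = 1" and "l = Max A"
    and "E = exceptional_set A" and "E' = exceptional_set (reflect l A)"
    and "M = l - n + 2"
  shows
    "(\<forall>m::nat. int m \<ge> M \<longrightarrow>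
        mfold_sumset m A = {0 .. int m * l} - (E \<union> reflect (int m * l) E'))
     \<and> (\<forall>m::nat. int m \<ge> M \<longrightarrow>
        {exc_max E + 1 .. reflect_min (int m * l) E' - 1} \<noteq> {} \<and>
        {exc_max E + 1 .. reflect_min (int m * l) E' - 1} \<subseteq> mfold_sumset m A)
     \<and> (\<exists>k r :: int. k \<ge> 1 \<and> r \<in> {0 .. n - 3} \<and> l - 1 = k * (n - 2) + r)
     \<and> (\<forall>k r \<Delta> :: int.
        k \<ge> 1 \<and> r \<in> {0 .. n - 3} \<and> l - 1 = k * (n - 2) + r \<and>
        \<Delta> = l * (k - 1) * (n - 3) + r * k * (n - 3) + r\<^sup>2 + k + 1 \<longrightarrow>
          \<Delta> \<ge> 2 \<and>
          (\<forall>m::nat. int m \<ge> M \<longrightarrow>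
             reflect_min (int m * l) E' - exc_max E \<ge> (int m - M + 1) * l + \<Delta>))"
proof -
  have ne: "A \<noteq> {}"
    using assms(2,3) by auto
  have A: "finite A" "A \<subseteq> {0..l}" "0 \<in> A" "l \<in> A"
    using assms(1,4,6) ne Min_le[of A] Max_ge[of A] Min_in[of A] Max_in[of A] by auto
  have "card A \<le> card {0..l}"
    using A(2) by (intro card_mono) auto
  then have ln: "l \<ge> n - 1"
    using assms(2,3) by simp
  then have l: "l > 0"
    using assms(3) by simp
  note R = reflect_properties[OF A assms(5)]
  have fin: "finite E" "finite E'"
    unfolding assms(7,8) using finite_exceptional_set A R l assms(5) by blast+
  have pos: "x > 0" if "x \<in> E \<or> x \<in> E'" for x
    using that by (auto simp: assms(7,8) exceptional_set_def)
  have max: "exc_max E \<ge> - 1" "exc_max E' \<ge> - 1"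
    using fin pos by (auto intro!: exc_max_lower)
  have rmin: "reflect_min c E' = c - exc_max E'" for c
    using fin(2) by (rule reflect_min_eq)
  have saturated: "mfold_sumset m A = {0..int m * l} - (E \<union> reflect (int m * l) E')"
    if "int m \<ge> M" for m
    using mfold_sumset_eq_complement[OF A l, of m] that assms(2,7-9) by simp
  have bound: "\<Delta> \<ge> 2 \<and> reflect_min (int m * l) E' - exc_max E \<ge> (int m - M + 1) * l + \<Delta>"
    if k: "k \<ge> 1" "r \<in> {0..n - 3}" "l - 1 = k * (n - 2) + r"
      and \<Delta>: "\<Delta> = l * (k - 1) * (n - 3) + r * k * (n - 3) + r\<^sup>2 + k + 1"
    for k r \<Delta> and m :: nat
  proof
    have "0 \<le> l * (k - 1) * (n - 3)" "0 \<le> r * k * (n - 3)"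
      using k l assms(3) by auto
    then show "\<Delta> \<ge> 2"
      using k(1) unfolding \<Delta> by (smt (verit) zero_le_power2)
    \<comment> \<open>\<open>b\<close> bounds twice the total size of the exceptional sets, hence
      their maxima add up to at most \<open>b - 2\<close>, one unit being lost for each maximum.
      \<Delta> is exactly \<open>(M - 1) * l - (b - 2)\<close>.\<close>
    define b where "b = 2 * k * (l - 1) - k * (k + 1) * (n - 2)"
    have "2 * (int (card E) + int (card E')) \<le> b"
      unfolding b_def using card_exceptional_sets_le[OF A l assms(5,2,3), of "nat k" r] k by (simp add: assms(7,8))
    moreover have "exc_max E + 1 \<le> 2 * int (card E)" "exc_max E' + 1 \<le> 2 * int (card E')"
      using exc_max_le_card A(1) R(1) fin unfolding assms(7,8) by blast+
    ultimately have "exc_max E + exc_max E' \<le> b - 2"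
      by simp
    also have "\<dots> = (M - 1) * l - \<Delta>"
    proof -
      have l_eq: "l = k * (n - 2) + r + 1"
        using k(3) by simp
      show ?thesis
        unfolding b_def \<Delta> assms(9) l_eq by (simp add: algebra_simps power2_eq_square)
    qed
    finally show "reflect_min (int m * l) E' - exc_max E \<ge> (int m - M + 1) * l + \<Delta>"
      by (simp add: rmin algebra_simps)
  qed
  define k where "k = (l - 1) div (n - 2)"
  define r where "r = (l - 1) mod (n - 2)"
  have kr: "k \<ge> 1" "r \<in> {0..n - 3}" "l - 1 = k * (n - 2) + r"
  proof -
    have "(n - 2) div (n - 2) \<le> k"
      unfolding k_def using ln assms(3) by (intro zdiv_mono1) auto
    then show "k \<ge> 1"
      using assms(3) by simp
    have "0 \<le> r" "r < n - 2"
      unfolding r_def using assms(3) by (auto intro: pos_mod_sign pos_mod_bound)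
    then show "r \<in> {0..n - 3}"
      by simp
    show "l - 1 = k * (n - 2) + r"
      unfolding k_def r_def by (rule div_mult_mod_eq[symmetric])
  qed
  have "{exc_max E + 1 .. reflect_min (int m * l) E' - 1} \<noteq> {} \<and>
      {exc_max E + 1 .. reflect_min (int m * l) E' - 1} \<subseteq> mfold_sumset m A"
    if m: "int m \<ge> M" for m
  proof
    have "0 \<le> (int m - M + 1) * l"
      using m l by simp
    \<comment> \<open>This is where \<open>\<Delta> \<ge> 2\<close> enters: an integer must fit
      strictly between the two extremes.\<close>
    then show "{exc_max E + 1 .. reflect_min (int m * l) E' - 1} \<noteq> {}"
      using bound[OF kr refl, of m] by simp
    show "{exc_max E + 1 .. reflect_min (int m * l) E' - 1} \<subseteq> mfold_sumset m A"
    proof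
      fix x assume x: "x \<in> {exc_max E + 1 .. reflect_min (int m * l) E' - 1}"
      then have "x \<notin> E"
        using exc_max_ge[OF fin(1), of x] by auto
      moreover have "int m * l - x \<notin> E'"
        using x exc_max_ge[OF fin(2), of "int m * l - x"] by (auto simp: rmin)
      \<comment> \<open>Both maxima being at least \<open>- 1\<close>, the interval stays within
        \<open>{0..int m * l}\<close>.\<close>
      ultimately show "x \<in> mfold_sumset m A"
        using x max by (simp add: saturated[OF m] mem_reflect_iff rmin)
    qed
  qed
  then show ?thesis
    using saturated bound kr by blast
qed

end
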